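(* Let $\Lambda$ be a finite strongly connected $k$-graph with vertex matrices $A_1,\dots,A_k$ whose spectral radii satisfy $\rho_i>1$ for all $1\le i\le k$, let $\delta\in(0,1)$, and assume that $\operatorname{diam}[\eta]=w_\delta(\eta)$ for every $\eta\in F\mathcal{B}_\Lambda$. Let $s\in\mathbb{R}$, let $\Delta_s$ be the Laplace-Beltrami operator associated to the Dirichlet form $Q_s$, and let $$\lambda_{s,\gamma}=\sum_{j=0}^{|\gamma|-1}\frac{\mu[\gamma_{j+1}]-\mu[\gamma_j]}{G_s(\gamma_j)}-\frac{\mu[\gamma]}{G_s(\gamma)}\qquad(\gamma\in F\mathcal{B}_\Lambda)$$ be its eigenvalues. If $s<2+\delta$, then $\lambda_{s,\gamma}\to-\infty$ as $|\gamma|\to\infty$; that is, for every $M>0$ there is $N$ such that $\lambda_{s,\gamma}<-M$ for all $\gamma\in F\mathcal{B}_\Lambda$ with $|\gamma|\ge N$.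
   Context: **$k$-graphs.** $\mathbb{N}=\{0,1,2,\dots\}$. A $k$-graph is a small category $\Lambda$ with a functor $d:\Lambda\to\mathbb{N}^k$ such that whenever $d(\lambda)=m+n$ there are unique $\alpha,\beta\in\Lambda$ with $\lambda=\alpha\beta$, $d(\alpha)=m$, $d(\beta)=n$. $\Lambda^n=d^{-1}(n)$, and $\Lambda^0$ is the set of vertices (objects); $r,s$ denote range and source. $\Lambda$ is finite if every $\Lambda^n$ is finite, and strongly connected if for all $v,w\in\Lambda^0$ there is a morphism with range $v$ and source $w$. The vertex matrices $A_i\in M_{\Lambda^0}(\mathbb{N})$, $A_i(v,w)=|\{\lambda\in\Lambda^{e_i}:r(\lambda)=v,\ s(\lambda)=w\}|$ ($e_i$ the $i$-th standard basis vector), commute. $\rho_i$ is the spectral radius of $A_i$. $\kappa^\Lambda\in(0,\infty)^{\Lambda^0}$ is the unique positive vector with $\sum_v\kappa^\Lambda_v=1$ and $A_i\kappa^\Lambda=\rho_i\kappa^\Lambda$ for all $i$ (Perron-Frobenius eigenvector). **Stationary $k$-Bratteli diagram $\mathcal{B}_\Lambda$.** It has vertex levels $V_0,V_1,\dots$, each a copy of $\Lambda^0$. For $n\ge1$ the $n$-th edge level consists of edges with source in $V_n$ and range in $V_{n-1}$: if $n\equiv i \pmod k$ with $1\le i\le k$, there are $A_i(p,q)$ edges with range $p\in V_{n-1}$ and source $q\in V_n$. $F\mathcal{B}_\Lambda$ is the set of finite paths $\eta=\eta_1\cdots\eta_n$ ($\eta_j$ in the $j$-th edge level, $s(\eta_j)=r(\eta_{j+1})$)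 starting with range in $V_0$, of length $|\eta|=n\ge0$; paths of length $0$ are the vertices of $V_0$. $\partial\mathcal{B}_\Lambda$ is the set of infinite paths $x=x_1x_2\cdots$ of the same kind, and $[\eta]\subseteq\partial\mathcal{B}_\Lambda$ is the cylinder set of infinite paths with initial segment $\eta$; cylinder sets generate the topology. $\gamma_j$ is the initial sub-path of $\gamma$ of length $j$. $x\wedge y$ is the longest common initial sub-path of $x\ne y$, and $x\wedge y=\emptyset$ if $r(x)\neq r(y)$. For $\eta\in F\mathcal{B}_\Lambda$, $\operatorname{ext}_1(\eta)$ is the set of ordered pairs $(e,e')$ of distinct edges such that $\eta e$ and $\eta e'$ are paths of length $|\eta|+1$. **Measure, weight, metric.** For $|\eta|=qk+t$ with $0\le t\le k-1$, $$\mu[\eta]=(\rho_1\cdots\rho_t)^{-(q+1)}(\rho_{t+1}\cdots\rho_k)^{-q}\kappa^\Lambda_{s(\eta)},\qquad w_\delta(\eta)=\big(\rho_1^{q+1}\cdots\rho_t^{q+1}\rho_{t+1}^q\cdots\rho_k^q\big)^{-1/\delta}\kappa^\Lambda_{s(\eta)};$$ $\mu$ extends to a Borel probability measure on $\partial\mathcal{B}_\Lambda$. The ultrametric $d_{w_\delta}$ is $d_{w_\delta}(x,x)=0$, $d_{w_\delta}(x,y)=1$ if $x\wedge y=\emptyset$, and $d_{w_\delta}(x,y)=w_\delta(x\wedge y)$ otherwise. $\operatorname{diam}[\eta]=\sup\{d_{w_\delta}(x,y):x,y\in[\eta]\}$. **Dirichlet form and Laplace-Beltrami operator.** A choice function is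 a map $\phi=(\phi_1,\phi_2):F\mathcal{B}_\Lambda\to\partial\mathcal{B}_\Lambda\times\partial\mathcal{B}_\Lambda$ with $\phi(\eta)\in[\eta]\times[\eta]$ and $d_{w_\delta}(\phi_1(\eta),\phi_2(\eta))=\operatorname{diam}[\eta]$ (equivalently $\phi_1(\eta)\wedge\phi_2(\eta)=\eta$). $\Xi$ is the set of choice functions, i.e. $\Xi=\prod_{\eta}\{(x,y):x\wedge y=\eta\}$, with product probability measure $\nu=\prod_\eta\nu_\eta$, where $\nu_\eta=(\mu\times\mu)/\sum_{(e,e')\in\operatorname{ext}_1(\eta)}\mu[\eta e]\mu[\eta e']$ on $\{(x,y):x\wedge y=\eta\}$. On $\mathcal{H}=\ell^2(F\mathcal{B}_\Lambda)\otimes\mathbb{C}^2$ put $\pi_\phi(g)=\bigoplus_\eta\operatorname{diag}(g(\phi_1(\eta)),g(\phi_2(\eta)))$ and $D=\bigoplus_\eta\frac1{w_\delta(\eta)}\begin{pmatrix}0&1\\1&0\end{pmatrix}$. For $f,g\in\operatorname{Dom}(Q_s)=\operatorname{span}\{\chi_{[\eta]}:\eta\in F\mathcal{B}_\Lambda\}\subset L^2(\partial\mathcal{B}_\Lambda,\mu)$, $$Q_s(f,g)=\tfrac12\int_\Xi\operatorname{Tr}\big(|D|^{-s}[D,\pi_\phi(f)]^*[D,\pi_\phi(g)]\big)\,d\nu(\phi).$$ $Q_s$ is closable, and $\Delta_s$ is the non-positive self-adjoint operator with $\langle-\Delta_sf,g\rangle=Q_s(f,g)$. For $\gamma\in F\mathcal{B}_\Lambda$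 the number $\lambda_{s,\gamma}$ is an eigenvalue of $\Delta_s$ with eigenspace $\operatorname{span}\{\chi_{[\gamma e]}/\mu[\gamma e]-\chi_{[\gamma e']}/\mu[\gamma e']:(e,e')\in\operatorname{ext}_1(\gamma)\}$, where $$G_s(\eta)=\tfrac12\,w_\delta(\eta)^{2-s}\sum_{(e,e')\in\operatorname{ext}_1(\eta)}\mu[\eta e]\,\mu[\eta e'].$$ *)

theory Defs
  imports "HOL-Probability.Probability" "Jordan_Normal_Form.Spectral_Radius"
begin

section \<open>Higher-rank graphs\<close>

text \<open>A small category with objects \<open>Obj\<close> and morphisms \<open>Mor\<close> together with a degree map.
  \<open>rg\<close> and \<open>sr\<close> are range and source; \<open>composite f g\<close> is meaningful when
  \<open>sr f = rg g\<close>.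
  A degree in \<open>\<nat>\<^sup>k\<close> is a function on \<open>nat\<close> that vanishes outside \<open>{1..k}\<close>.\<close>

record ('v, 'a) kgraph =
  rk :: nat
  Obj :: "'v set"
  Mor :: "'a set"
  rg :: "'a \<Rightarrow> 'v"
  sr :: "'a \<Rightarrow> 'v"
  ident :: "'v \<Rightarrow> 'a"
  composite :: "'a \<Rightarrow> 'a \<Rightarrow> 'a"
  deg :: "'a \<Rightarrow> nat \<Rightarrow> nat"

definition degrees :: "nat \<Rightarrow> (nat \<Rightarrow> nat) set" where
  "degrees k = {n. \<forall>i. i \<notin> {1..k} \<longrightarrow> n i = 0}"

definition unit_degree :: "nat \<Rightarrow> nat \<Rightarrow> nat" where
  "unit_degree i = (\<lambda>j. if j = i then 1 else 0)"

definition small_category :: "('v, 'a) kgraph \<Rightarrow> bool" where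
  "small_category L \<longleftrightarrow>
     (\<forall>v\<in>Obj L. ident L v \<in> Mor L \<and> rg L (ident L v) = v \<and> sr L (ident L v) = v) \<and>
     (\<forall>f\<in>Mor L. rg L f \<in> Obj L \<and> sr L f \<in> Obj L \<and>
        composite L (ident L (rg L f)) f = f \<and> composite L f (ident L (sr L f)) = f) \<and>
     (\<forall>f\<in>Mor L. \<forall>g\<in>Mor L. sr L f = rg L g \<longrightarrow>
        composite L f g \<in> Mor L \<and> rg L (composite L f g) = rg L f \<and>
        sr L (composite L f g) = sr L g) \<and>
     (\<forall>f\<in>Mor L. \<forall>g\<in>Mor L. \<forall>h\<in>Mor L. sr L f = rg L g \<longrightarrow> sr L g = rg L h \<longrightarrow>
        composite L (composite L f g) h = composite L f (composite L g h))"

definition k_graph :: "('v, 'a) kgraph \<Rightarrow> bool" where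
  "k_graph L \<longleftrightarrow> 1 \<le> rk L \<and> small_category L \<and>
     (\<forall>f\<in>Mor L. deg L f \<in> degrees (rk L)) \<and>
     (\<forall>v\<in>Obj L. deg L (ident L v) = (\<lambda>i. 0)) \<and>
     (\<forall>f\<in>Mor L. \<forall>g\<in>Mor L. sr L f = rg L g \<longrightarrow>
        deg L (composite L f g) = (\<lambda>i. deg L f i + deg L g i)) \<and>
     (\<forall>f\<in>Mor L. \<forall>m\<in>degrees (rk L). \<forall>n\<in>degrees (rk L). deg L f = (\<lambda>i. m i + n i) \<longrightarrow>
        (\<exists>!(a, b). a \<in> Mor L \<and> b \<in> Mor L \<and> sr L a = rg L b \<and>
           f = composite L a b \<and> deg L a = m \<and> deg L b = n))"

definition finite_kgraph :: "('v, 'a) kgraph \<Rightarrow> bool" where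
  "finite_kgraph L \<longleftrightarrow> (\<forall>n\<in>degrees (rk L). finite {f \<in> Mor L. deg L f = n})"

definition strongly_connected_kgraph :: "('v, 'a) kgraph \<Rightarrow> bool" where
  "strongly_connected_kgraph L \<longleftrightarrow>
     (\<forall>v\<in>Obj L. \<forall>w\<in>Obj L. \<exists>f\<in>Mor L. rg L f = v \<and> sr L f = w)"

definition vertex_matrix :: "('v, 'a) kgraph \<Rightarrow> nat \<Rightarrow> 'v \<Rightarrow> 'v \<Rightarrow> nat" where
  "vertex_matrix L i v w =
     card {f \<in> Mor L. deg L f = unit_degree i \<and> rg L f = v \<and> sr L f = w}"

text \<open>Library matrices are indexed by natural numbers, hence the enumeration of the vertices;
  the spectral radius does not depend on its choice.\<close>

definition vertex_list :: "('v, 'a) kgraph \<Rightarrow> 'v list" where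
  "vertex_list L = (SOME vs. distinct vs \<and> set vs = Obj L)"

definition rho :: "('v, 'a) kgraph \<Rightarrow> nat \<Rightarrow> real" where
  "rho L i = (let vs = vertex_list L; n = length vs in
     spectral_radius (Matrix.mat n n (\<lambda>(a, b). of_nat (vertex_matrix L i (vs ! a) (vs ! b)))))"

definition perron_frobenius_vector :: "('v, 'a) kgraph \<Rightarrow> ('v \<Rightarrow> real) \<Rightarrow> bool" where
  "perron_frobenius_vector L \<kappa> \<longleftrightarrow>
     (\<forall>v\<in>Obj L. 0 < \<kappa> v) \<and> (\<Sum>v\<in>Obj L. \<kappa> v) = 1 \<and>
     (\<forall>i\<in>{1..rk L}. \<forall>v\<in>Obj L.
        (\<Sum>w\<in>Obj L. real (vertex_matrix L i v w) * \<kappa> w) = rho L i * \<kappa> v)"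


section \<open>The stationary Bratteli diagram\<close>

text \<open>An edge \<open>(p, q, m)\<close> has range \<open>p\<close> and source \<open>q\<close>; the index \<open>m\<close> separates
  parallel edges.\<close>

type_synonym 'v edge = "'v \<times> 'v \<times> nat"

definition erange :: "'v edge \<Rightarrow> 'v" where "erange e = fst e"
definition esource :: "'v edge \<Rightarrow> 'v" where "esource e = fst (snd e)"

text \<open>For \<open>n \<ge> 1\<close> the colour \<open>(n - 1) mod k + 1\<close> is the \<open>i\<close> in \<open>{1..k}\<close> congruent
  to \<open>n\<close> modulo \<open>k\<close>.\<close>

definition edge_level :: "('v, 'a) kgraph \<Rightarrow> nat \<Rightarrow> 'v edge set" where
  "edge_level L n = {(p, q, m). p \<in> Obj L \<and> q \<in> Obj L \<and>
     m < vertex_matrix L ((n - 1) mod rk L + 1) p q}"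

text \<open>A finite path is its range in \<open>V\<^sub>0\<close> together with its list of edges, so that paths of
  length \<open>0\<close> are vertices. The list entry \<open>es ! j\<close> lies in edge level \<open>j + 1\<close>; likewise
  for the values \<open>x j\<close> of an infinite path \<open>x\<close>.\<close>

type_synonym 'v fpath = "'v \<times> 'v edge list"
type_synonym 'v ipath = "nat \<Rightarrow> 'v edge"

definition finite_paths :: "('v, 'a) kgraph \<Rightarrow> 'v fpath set" where
  "finite_paths L = {(v, es). v \<in> Obj L \<and> (\<forall>j<length es. es ! j \<in> edge_level L (Suc j)) \<and>
     (\<forall>j. Suc j < length es \<longrightarrow> esource (es ! j) = erange (es ! Suc j)) \<and>
     (es \<noteq> [] \<longrightarrow> erange (hd es) = v)}"

definition infinite_paths :: "('v, 'a) kgraph \<Rightarrow> 'v ipath set" where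
  "infinite_paths L = {x. \<forall>j. x j \<in> edge_level L (Suc j) \<and> esource (x j) = erange (x (Suc j))}"

definition plength :: "'v fpath \<Rightarrow> nat" where
  "plength \<eta> = length (snd \<eta>)"

definition psource :: "'v fpath \<Rightarrow> 'v" where
  "psource \<eta> = (if snd \<eta> = [] then fst \<eta> else esource (last (snd \<eta>)))"

definition sub_path :: "'v fpath \<Rightarrow> nat \<Rightarrow> 'v fpath" where
  "sub_path \<eta> j = (fst \<eta>, take j (snd \<eta>))"

definition add_edge :: "'v fpath \<Rightarrow> 'v edge \<Rightarrow> 'v fpath" where
  "add_edge \<eta> e = (fst \<eta>, snd \<eta> @ [e])"

definition initial :: "nat \<Rightarrow> 'v ipath \<Rightarrow> 'v fpath" where
  "initial n x = (erange (x 0), map x [0..<n])"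

definition cylinder :: "('v, 'a) kgraph \<Rightarrow> 'v fpath \<Rightarrow> 'v ipath set" where
  "cylinder L \<eta> = {x \<in> infinite_paths L. initial (plength \<eta>) x = \<eta>}"

text \<open>The longest common initial sub-path of \<open>x \<noteq> y\<close>; \<open>None\<close> stands for
  \<open>x \<and> y = \<emptyset>\<close>. The value for \<open>x = y\<close> is irrelevant.\<close>

definition path_meet :: "'v ipath \<Rightarrow> 'v ipath \<Rightarrow> 'v fpath option" where
  "path_meet x y = (if erange (x 0) \<noteq> erange (y 0) then None
     else Some (initial (GREATEST n. initial n x = initial n y) x))"

definition ext1 :: "('v, 'a) kgraph \<Rightarrow> 'v fpath \<Rightarrow> ('v edge \<times> 'v edge) set" where
  "ext1 L \<eta> = {(e, e'). e \<noteq> e' \<and> add_edge \<eta> e \<in> finite_paths L \<and> add_edge \<eta> e' \<in> finite_paths L}"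


section \<open>Measure, weight and metric\<close>

definition mu :: "('v, 'a) kgraph \<Rightarrow> ('v \<Rightarrow> real) \<Rightarrow> 'v fpath \<Rightarrow> real" where
  "mu L \<kappa> \<eta> = (let q = plength \<eta> div rk L; t = plength \<eta> mod rk L in
     (\<Prod>i=1..t. rho L i) powi (- (int q + 1)) * (\<Prod>i=t+1..rk L. rho L i) powi (- int q)
       * \<kappa> (psource \<eta>))"

definition weight :: "('v, 'a) kgraph \<Rightarrow> ('v \<Rightarrow> real) \<Rightarrow> real \<Rightarrow> 'v fpath \<Rightarrow> real" where
  "weight L \<kappa> \<delta> \<eta> = (let q = plength \<eta> div rk L; t = plength \<eta> mod rk L in
     ((\<Prod>i=1..t. rho L i ^ (q + 1)) * (\<Prod>i=t+1..rk L. rho L i ^ q)) powr (- 1 / \<delta>)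
       * \<kappa> (psource \<eta>))"

text \<open>The probability measure on the space of infinite paths with \<open>\<mu>[\<eta>] = mu L \<kappa> \<eta>\<close>,
  on the \<open>\<sigma>\<close>-algebra generated by the cylinder sets (which is the Borel one, there being only
  countably many cylinder sets).\<close>

definition path_measure :: "('v, 'a) kgraph \<Rightarrow> ('v \<Rightarrow> real) \<Rightarrow> 'v ipath measure" where
  "path_measure L \<kappa> = extend_measure (infinite_paths L) (finite_paths L) (cylinder L)
     (\<lambda>\<eta>. ennreal (mu L \<kappa> \<eta>))"

definition path_dist ::
    "('v, 'a) kgraph \<Rightarrow> ('v \<Rightarrow> real) \<Rightarrow> real \<Rightarrow> 'v ipath \<Rightarrow> 'v ipath \<Rightarrow> real" where
  "path_dist L \<kappa> \<delta> x y = (if x = y then 0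
     else (case path_meet x y of None \<Rightarrow> 1 | Some \<eta> \<Rightarrow> weight L \<kappa> \<delta> \<eta>))"

definition cylinder_diam :: "('v, 'a) kgraph \<Rightarrow> ('v \<Rightarrow> real) \<Rightarrow> real \<Rightarrow> 'v fpath \<Rightarrow> real" where
  "cylinder_diam L \<kappa> \<delta> \<eta> =
     Sup {path_dist L \<kappa> \<delta> x y | x y. x \<in> cylinder L \<eta> \<and> y \<in> cylinder L \<eta>}"


section \<open>The Dirichlet form\<close>

definition branch_pairs :: "('v, 'a) kgraph \<Rightarrow> 'v fpath \<Rightarrow> ('v ipath \<times> 'v ipath) set" where
  "branch_pairs L \<eta> =
     {(x, y) \<in> infinite_paths L \<times> infinite_paths L. x \<noteq> y \<and> path_meet x y = Some \<eta>}"

definition ext_mass :: "('v, 'a) kgraph \<Rightarrow> ('v \<Rightarrow> real) \<Rightarrow> 'v fpath \<Rightarrow> real" where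
  "ext_mass L \<kappa> \<eta> = (\<Sum>(e, e')\<in>ext1 L \<eta>. mu L \<kappa> (add_edge \<eta> e) * mu L \<kappa> (add_edge \<eta> e'))"

definition branch_measure ::
    "('v, 'a) kgraph \<Rightarrow> ('v \<Rightarrow> real) \<Rightarrow> 'v fpath \<Rightarrow> ('v ipath \<times> 'v ipath) measure" where
  "branch_measure L \<kappa> \<eta> = scale_measure (ennreal (1 / ext_mass L \<kappa> \<eta>))
     (restrict_space (path_measure L \<kappa> \<Otimes>\<^sub>M path_measure L \<kappa>) (branch_pairs L \<eta>))"

text \<open>Its underlying space is the set \<open>\<Xi>\<close> of choice functions, the product of the sets
  \<open>branch_pairs L \<eta>\<close>.\<close>

definition choice_measure ::
    "('v, 'a) kgraph \<Rightarrow> ('v \<Rightarrow> real) \<Rightarrow> ('v fpath \<Rightarrow> 'v ipath \<times> 'v ipath) measure" where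
  "choice_measure L \<kappa> = PiM (finite_paths L) (branch_measure L \<kappa>)"

text \<open>The operators on \<open>\<ell>\<^sup>2(F\<B>) \<otimes> \<complex>\<^sup>2\<close> occurring in the form are all direct sums
  of \<open>2 \<times> 2\<close> matrices indexed by the finite paths. They are given by their blocks, and the trace is
  the sum of the traces of the blocks. Since \<open>D\<^sup>* D\<close> has the block \<open>w\<^sup>-\<^sup>2 1\<close>, the block of
  \<open>|D|\<^sup>-\<^sup>s\<close> is \<open>(1 / w)\<^sup>-\<^sup>s 1\<close>.\<close>

definition pi_block ::
    "('v fpath \<Rightarrow> 'v ipath \<times> 'v ipath) \<Rightarrow> ('v ipath \<Rightarrow> complex) \<Rightarrow> 'v fpath \<Rightarrow> complex^2^2" where
  "pi_block \<phi> g \<eta> = vector [vector [g (fst (\<phi> \<eta>)), 0], vector [0, g (snd (\<phi> \<eta>))]]"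

definition D_block ::
    "('v, 'a) kgraph \<Rightarrow> ('v \<Rightarrow> real) \<Rightarrow> real \<Rightarrow> 'v fpath \<Rightarrow> complex^2^2" where
  "D_block L \<kappa> \<delta> \<eta> = (let c = complex_of_real (1 / weight L \<kappa> \<delta> \<eta>) in
     vector [vector [0, c], vector [c, 0]])"

definition abs_D_powr_block ::
    "('v, 'a) kgraph \<Rightarrow> ('v \<Rightarrow> real) \<Rightarrow> real \<Rightarrow> real \<Rightarrow> 'v fpath \<Rightarrow> complex^2^2" where
  "abs_D_powr_block L \<kappa> \<delta> a \<eta> =
     Finite_Cartesian_Product.mat (complex_of_real ((1 / weight L \<kappa> \<delta> \<eta>) powr a))"

definition commutator_block ::
    "('v, 'a) kgraph \<Rightarrow> ('v \<Rightarrow> real) \<Rightarrow> real \<Rightarrow> ('v fpath \<Rightarrow> 'v ipath \<times> 'v ipath) \<Rightarrow>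
     ('v ipath \<Rightarrow> complex) \<Rightarrow> 'v fpath \<Rightarrow> complex^2^2" where
  "commutator_block L \<kappa> \<delta> \<phi> g \<eta> =
     D_block L \<kappa> \<delta> \<eta> ** pi_block \<phi> g \<eta> - pi_block \<phi> g \<eta> ** D_block L \<kappa> \<delta> \<eta>"

definition dirichlet_form ::
    "('v, 'a) kgraph \<Rightarrow> ('v \<Rightarrow> real) \<Rightarrow> real \<Rightarrow> real \<Rightarrow>
     ('v ipath \<Rightarrow> complex) \<Rightarrow> ('v ipath \<Rightarrow> complex) \<Rightarrow> complex" where
  "dirichlet_form L \<kappa> \<delta> s f g = 1 / 2 * (\<integral>\<phi>. (\<Sum>\<^sub>\<infinity>\<eta>\<in>finite_paths L.
     Determinants.trace (abs_D_powr_block L \<kappa> \<delta> (- s) \<eta> **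
       map_matrix cnj (Finite_Cartesian_Product.transpose (commutator_block L \<kappa> \<delta> \<phi> f \<eta>)) **
       commutator_block L \<kappa> \<delta> \<phi> g \<eta>)) \<partial>choice_measure L \<kappa>)"

definition form_domain :: "('v, 'a) kgraph \<Rightarrow> ('v ipath \<Rightarrow> complex) set" where
  "form_domain L = {f. \<exists>S c. finite S \<and> S \<subseteq> finite_paths L \<and>
     f = (\<lambda>x. \<Sum>\<eta>\<in>S. c \<eta> * indicator (cylinder L \<eta>) x)}"


section \<open>The Laplace-Beltrami operator\<close>

definition square_integrable :: "'b measure \<Rightarrow> ('b \<Rightarrow> complex) \<Rightarrow> bool" where
  "square_integrable M f \<longleftrightarrow> f \<in> borel_measurable M \<and> integrable M (\<lambda>x. (cmod (f x))\<^sup>2)"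

definition L2_inner :: "'b measure \<Rightarrow> ('b \<Rightarrow> complex) \<Rightarrow> ('b \<Rightarrow> complex) \<Rightarrow> complex" where
  "L2_inner M f g = (\<integral>x. cnj (f x) * g x \<partial>M)"

text \<open>The operator associated with the closure of the form, as a relation between
  representatives of classes in \<open>L\<^sup>2\<close>: \<open>f\<close> is in the domain of \<open>\<Delta>\<^sub>s\<close> and
  \<open>\<Delta>\<^sub>s f = h\<close> iff \<open>f\<close> is in the domain of the closure (it is an \<open>L\<^sup>2\<close>-limit of a
  sequence of form-domain functions that is Cauchy for the form) and the closed form at \<open>(f, g)\<close>
  equals the inner product of \<open>-h\<close> and \<open>g\<close> for all \<open>g\<close> in the core \<open>form_domain L\<close>.\<close>

definition laplace_beltrami ::
    "('v, 'a) kgraph \<Rightarrow> ('v \<Rightarrow> real) \<Rightarrow> real \<Rightarrow> real \<Rightarrow>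
     ('v ipath \<Rightarrow> complex) \<Rightarrow> ('v ipath \<Rightarrow> complex) \<Rightarrow> bool" where
  "laplace_beltrami L \<kappa> \<delta> s f h \<longleftrightarrow>
     square_integrable (path_measure L \<kappa>) f \<and> square_integrable (path_measure L \<kappa>) h \<and>
     (\<exists>F. (\<forall>n. F n \<in> form_domain L) \<and>
        (\<lambda>n. \<integral>x. (cmod (F n x - f x))\<^sup>2 \<partial>path_measure L \<kappa>) \<longlonglongrightarrow> 0 \<and>
        (\<forall>\<epsilon>>0. \<exists>N::nat. \<forall>m\<ge>N. \<forall>n\<ge>N.
           cmod (dirichlet_form L \<kappa> \<delta> s (\<lambda>x. F m x - F n x) (\<lambda>x. F m x - F n x)) < \<epsilon>) \<and>
        (\<forall>g\<in>form_domain L. (\<lambda>n. dirichlet_form L \<kappa> \<delta> s (F n) g)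
           \<longlonglongrightarrow> L2_inner (path_measure L \<kappa>) (\<lambda>x. - h x) g))"

definition laplace_eigenvalue ::
    "('v, 'a) kgraph \<Rightarrow> ('v \<Rightarrow> real) \<Rightarrow> real \<Rightarrow> real \<Rightarrow> real \<Rightarrow> bool" where
  "laplace_eigenvalue L \<kappa> \<delta> s c \<longleftrightarrow>
     (\<exists>f. laplace_beltrami L \<kappa> \<delta> s f (\<lambda>x. complex_of_real c * f x) \<and>
        \<not> (AE x in path_measure L \<kappa>. f x = 0))"

definition G_fun :: "('v, 'a) kgraph \<Rightarrow> ('v \<Rightarrow> real) \<Rightarrow> real \<Rightarrow> real \<Rightarrow> 'v fpath \<Rightarrow> real" where
  "G_fun L \<kappa> \<delta> s \<eta> = 1 / 2 * weight L \<kappa> \<delta> \<eta> powr (2 - s) *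
     (\<Sum>(e, e')\<in>ext1 L \<eta>. mu L \<kappa> (add_edge \<eta> e) * mu L \<kappa> (add_edge \<eta> e'))"

definition eigval :: "('v, 'a) kgraph \<Rightarrow> ('v \<Rightarrow> real) \<Rightarrow> real \<Rightarrow> real \<Rightarrow> 'v fpath \<Rightarrow> real" where
  "eigval L \<kappa> \<delta> s \<gamma> =
     (\<Sum>j<plength \<gamma>. (mu L \<kappa> (sub_path \<gamma> (Suc j)) - mu L \<kappa> (sub_path \<gamma> j))
        / G_fun L \<kappa> \<delta> s (sub_path \<gamma> j))
     - mu L \<kappa> \<gamma> / G_fun L \<kappa> \<delta> s \<gamma>"

section \<open>The numbers \<open>eigval\<close> are eigenvalues of the Laplace-Beltrami operator\<close>

text \<open>The development ends with \<open>eigval_laplace_beltrami\<close>: on the cylinder differences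
  \<open>\<chi>[\<gamma>e] / \<mu>[\<gamma>e] - \<chi>[\<gamma>e'] / \<mu>[\<gamma>e']\<close> the operator acts as multiplication by
  \<open>eigval L \<kappa> \<delta> s \<gamma>\<close>. The measure is realised as the law of a Markov chain driven by
  independent choices of an edge at every level and vertex.\<close>

locale pf_kgraph =
  fixes L :: "('v, 'a) kgraph" and \<kappa> :: "'v \<Rightarrow> real" and \<delta> s :: real
  assumes kg: "k_graph L" and fin: "finite_kgraph L"
    and rho_gt1: "\<And>i. i \<in> {1..rk L} \<Longrightarrow> rho L i > 1"
    and pf: "perron_frobenius_vector L \<kappa>"
    and delta: "0 < \<delta>" "\<delta> < 1"
    and diam: "\<And>\<eta>. \<eta> \<in> finite_paths L \<Longrightarrow> cylinder_diam L \<kappa> \<delta> \<eta> = weight L \<kappa> \<delta> \<eta>"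
begin

abbreviation "FB \<equiv> finite_paths L"
abbreviation "PB \<equiv> infinite_paths L"
abbreviation "cyl \<equiv> cylinder L"
abbreviation "m \<equiv> mu L \<kappa>"
abbreviation "w \<equiv> weight L \<kappa> \<delta>"
abbreviation "M \<equiv> path_measure L \<kappa>"

definition col :: "nat \<Rightarrow> nat" where "col n = n mod rk L + 1"

definition out_edges :: "nat \<Rightarrow> 'v \<Rightarrow> 'v edge set" where
  "out_edges n p = {e \<in> edge_level L (Suc n). erange e = p}"

lemma rk_pos: "1 \<le> rk L" using kg by (simp add: k_graph_def)

lemma col_in: "col n \<in> {1..rk L}"
  using rk_pos by (auto simp: col_def Suc_le_eq)

lemma rho_pos: "rho L (col n) > 0" and rho_col: "rho L (col n) > 1"
  using rho_gt1[OF col_in[of n]] by auto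

lemma finite_Obj: "finite (Obj L)"
proof -
  have z: "(\<lambda>i. 0) \<in> degrees (rk L)" by (simp add: degrees_def)
  have "finite {f \<in> Mor L. deg L f = (\<lambda>i. 0)}"
    using fin z by (auto simp: finite_kgraph_def)
  moreover have "ident L ` Obj L \<subseteq> {f \<in> Mor L. deg L f = (\<lambda>i. 0)}"
    using kg by (auto simp: k_graph_def small_category_def)
  moreover have "inj_on (ident L) (Obj L)"
    using kg unfolding k_graph_def small_category_def inj_on_def by metis
  ultimately show ?thesis by (meson finite_imageD finite_subset)
qed

lemma kappa_pos: "v \<in> Obj L \<Longrightarrow> \<kappa> v > 0"
  and kappa_sum: "(\<Sum>v\<in>Obj L. \<kappa> v) = 1"
  using pf by (auto simp: perron_frobenius_vector_def)

lemma out_edges_eq: "p \<in> Obj L \<Longrightarrow>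
   out_edges n p = Pair p ` (SIGMA q:Obj L. {..<vertex_matrix L (col n) p q})"
  by (auto simp: out_edges_def edge_level_def col_def erange_def)

lemma finite_out: "p \<in> Obj L \<Longrightarrow> finite (out_edges n p)"
  using finite_Obj by (auto simp: out_edges_eq)

lemma out_sum: assumes p: "p \<in> Obj L"
  shows "(\<Sum>e\<in>out_edges n p. \<kappa> (esource e)) = rho L (col n) * \<kappa> p"
proof -
  have "(\<Sum>e\<in>out_edges n p. \<kappa> (esource e)) =
     (\<Sum>z\<in>(SIGMA q:Obj L. {..<vertex_matrix L (col n) p q}). \<kappa> (fst z))"
    unfolding out_edges_eq[OF p]
    by (subst sum.reindex) (auto simp: inj_on_def esource_def)
  also have "\<dots> = (\<Sum>q\<in>Obj L. \<Sum>j<vertex_matrix L (col n) p q. \<kappa> q)"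
    using finite_Obj by (subst sum.Sigma) (auto simp: case_prod_beta)
  also have "\<dots> = rho L (col n) * \<kappa> p"
    using pf col_in[of n] p by (simp add: perron_frobenius_vector_def)
  finally show ?thesis .
qed

lemma out_edges_Obj: "e \<in> out_edges n p \<Longrightarrow> esource e \<in> Obj L"
  by (auto simp: out_edges_def edge_level_def esource_def)

lemma out_nonempty: assumes p: "p \<in> Obj L" shows "out_edges n p \<noteq> {}"
  using out_sum[OF p, of n] rho_pos[of n] kappa_pos[OF p] by auto

lemma psource_Obj: assumes "\<eta> \<in> FB" shows "psource \<eta> \<in> Obj L"
proof (cases "snd \<eta> = []")
  case False
  have "snd \<eta> ! (length (snd \<eta>) - 1) \<in> edge_level L (Suc (length (snd \<eta>) - 1))"
    using assms False unfolding finite_paths_def by (auto simp del: Suc_pred)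
  then have "last (snd \<eta>) \<in> edge_level L (length (snd \<eta>))"
    using False by (simp add: last_conv_nth)
  then show ?thesis using False by (auto simp: psource_def edge_level_def esource_def)
qed (use assms in \<open>auto simp: finite_paths_def psource_def\<close>)

lemma extend_FB_iff: assumes "\<eta> \<in> FB"
  shows "add_edge \<eta> e \<in> FB \<longleftrightarrow> e \<in> out_edges (plength \<eta>) (psource \<eta>)"
proof (cases \<eta>)
  case (Pair v es)
  show ?thesis
  proof (cases "es = []")
    case True
    then show ?thesis using assms Pair
      by (auto simp: finite_paths_def add_edge_def out_edges_def plength_def psource_def)
  next
    case False
    have "(\<forall>j<Suc (length es). (es @ [e]) ! j \<in> edge_level L (Suc j)) \<longleftrightarrow>
       (\<forall>j<length es. es ! j \<in> edge_level L (Suc j)) \<and> e \<in> edge_level L (Suc (length es))"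
      by (auto simp: nth_append less_Suc_eq)
    moreover have "(\<forall>j. Suc j < Suc (length es) \<longrightarrow>
         esource ((es @ [e]) ! j) = erange ((es @ [e]) ! Suc j)) \<longleftrightarrow>
       (\<forall>j. Suc j < length es \<longrightarrow> esource (es ! j) = erange (es ! Suc j)) \<and>
       esource (last es) = erange e" (is "?a \<longleftrightarrow> ?b \<and> ?c")
    proof
      assume a: ?a
      have ?b using a by (auto simp: nth_append)
      moreover have ?c using a[rule_format, of "length es - 1"] False
        by (auto simp: nth_append last_conv_nth)
      ultimately show "?b \<and> ?c" ..
    next
      assume bc: "?b \<and> ?c"
      show ?a
      proof (intro allI impI)
        fix j assume j: "Suc j < Suc (length es)"
        show "esource ((es @ [e]) ! j) = erange ((es @ [e]) ! Suc j)"
        proof (cases "Suc j = length es")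
          case True
          then have "j = length es - 1" by simp
          then show ?thesis using bc False True j by (auto simp: nth_append last_conv_nth)
        next
          case c: False
          then show ?thesis using bc j by (auto simp: nth_append)
        qed
      qed
    qed
    ultimately show ?thesis using assms Pair False
      by (auto simp: finite_paths_def add_edge_def out_edges_def plength_def psource_def)
  qed
qed

lemma psource_extend[simp]: "psource (add_edge \<eta> e) = esource e"
  and plength_extend[simp]: "plength (add_edge \<eta> e) = Suc (plength \<eta>)"
  by (auto simp: psource_def add_edge_def plength_def)

lemma ext1_eq: "\<eta> \<in> FB \<Longrightarrow> ext1 L \<eta> = {(e, e'). e \<noteq> e' \<and> e \<in> out_edges (plength \<eta>) (psource \<eta>)
    \<and> e' \<in> out_edges (plength \<eta>) (psource \<eta>)}"
  by (auto simp: ext1_def extend_FB_iff)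

definition cfac :: "nat \<Rightarrow> real" where
  "cfac n = (\<Prod>j<n. rho L (col j))"

lemma cfac_pos: "cfac n > 0"
  unfolding cfac_def by (intro prod_pos) (auto simp: rho_pos)

lemma cfac_eq: "cfac n = (\<Prod>i=1..n mod rk L. rho L i ^ (n div rk L + 1)) *
    (\<Prod>i=n mod rk L + 1..rk L. rho L i ^ (n div rk L))"
proof (induction n)
  case 0
  then show ?case by (simp add: cfac_def)
next
  case (Suc n)
  let ?k = "rk L" and ?q = "n div rk L" and ?t = "n mod rk L"
  have tk: "?t < ?k" using rk_pos by simp
  have split: "(\<Prod>i=?t + 1..?k. rho L i ^ ?q) = rho L (?t + 1) ^ ?q * (\<Prod>i=?t + 2..?k. rho L i ^ ?q)"
    using tk by (subst prod.atLeast_Suc_atMost) auto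
  have "cfac (Suc n) = (\<Prod>i=1..?t. rho L i ^ (?q + 1)) * (rho L (?t + 1) ^ ?q *
      (\<Prod>i=?t + 2..?k. rho L i ^ ?q)) * rho L (?t + 1)"
    using Suc split by (simp add: cfac_def col_def)
  also have "\<dots> = (\<Prod>i=1..?t + 1. rho L i ^ (?q + 1)) * (\<Prod>i=?t + 2..?k. rho L i ^ ?q)"
    by (simp add: algebra_simps)
  finally have *: "cfac (Suc n) =
     (\<Prod>i=1..?t + 1. rho L i ^ (?q + 1)) * (\<Prod>i=?t + 2..?k. rho L i ^ ?q)" .
  show ?case
  proof (cases "Suc ?t = ?k")
    case True
    then have "Suc n mod ?k = 0" "Suc n div ?k = Suc ?q"
      by (auto simp: mod_Suc div_Suc)
    then show ?thesis using * True by simp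
  next
    case False
    then have "Suc n mod ?k = Suc ?t" "Suc n div ?k = ?q"
      by (auto simp: mod_Suc div_Suc)
    then show ?thesis using * by simp
  qed
qed

lemma m_eq: "m \<eta> = \<kappa> (psource \<eta>) / cfac (plength \<eta>)"
proof -
  have "cfac n = (\<Prod>i=1..n mod rk L. rho L i) ^ (n div rk L + 1) *
    (\<Prod>i=n mod rk L + 1..rk L. rho L i) ^ (n div rk L)" for n
    by (simp only: cfac_eq prod_power_distrib)
  moreover have "x powi (- (int q + 1)) = 1 / x ^ (q + 1)" for x :: real and q
    using power_int_minus_divide[of x "int (q + 1)"] unfolding power_int_of_nat by (simp add: add.commute)
  ultimately show ?thesis
    by (simp add: mu_def Let_def power_int_minus field_simps)
qed

lemma w_eq: "w \<eta> = cfac (plength \<eta>) powr (- 1 / \<delta>) * \<kappa> (psource \<eta>)"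
  by (simp only: weight_def Let_def cfac_eq)

lemma m_pos: "\<eta> \<in> FB \<Longrightarrow> m \<eta> > 0"
  and w_pos: "\<eta> \<in> FB \<Longrightarrow> w \<eta> > 0"
  by (auto simp: m_eq w_eq kappa_pos psource_Obj cfac_pos less_imp_neq[OF cfac_pos, symmetric])

lemma m_sum: assumes "\<eta> \<in> FB"
  shows "(\<Sum>e\<in>out_edges (plength \<eta>) (psource \<eta>). m (add_edge \<eta> e)) = m \<eta>"
proof -
  have "(\<Sum>e\<in>out_edges (plength \<eta>) (psource \<eta>). m (add_edge \<eta> e)) =
    (\<Sum>e\<in>out_edges (plength \<eta>) (psource \<eta>). \<kappa> (esource e)) / cfac (Suc (plength \<eta>))"
    by (simp add: m_eq sum_divide_distrib)
  also have "\<dots> = m \<eta>"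
    using out_sum[OF psource_Obj[OF assms]] rho_pos[of "plength \<eta>"]
    by (simp add: m_eq cfac_def)
  finally show ?thesis .
qed

lemma sub_path_FB: "\<gamma> \<in> FB \<Longrightarrow> sub_path \<gamma> j \<in> FB"
  by (auto simp: finite_paths_def sub_path_def)

lemma plength_sub_path: "j \<le> plength \<gamma> \<Longrightarrow> plength (sub_path \<gamma> j) = j"
  by (auto simp: plength_def sub_path_def)

lemma sub_path_Suc: "j < plength \<gamma> \<Longrightarrow> sub_path \<gamma> (Suc j) = add_edge (sub_path \<gamma> j) (snd \<gamma> ! j)"
  by (auto simp: plength_def sub_path_def add_edge_def take_Suc_conv_app_nth)

lemma sub_path_all: "sub_path \<gamma> (plength \<gamma>) = \<gamma>"
  by (auto simp: plength_def sub_path_def)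

lemma sub_path_extend: "j \<le> plength \<gamma> \<Longrightarrow> sub_path (add_edge \<gamma> e) j = sub_path \<gamma> j"
  by (auto simp: plength_def sub_path_def add_edge_def)

lemma plength_initial[simp]: "plength (initial n x) = n"
  by (simp add: plength_def initial_def)

lemma initial_Suc: "initial (Suc n) x = add_edge (initial n x) (x n)"
  by (simp add: initial_def add_edge_def)

lemma extend_inject[simp]: "add_edge \<eta> e = add_edge \<eta>' e' \<longleftrightarrow> \<eta> = \<eta>' \<and> e = e'"
  by (auto simp: add_edge_def prod_eq_iff)

lemma sub_path_initial: "j \<le> n \<Longrightarrow> sub_path (initial n x) j = initial j x"
  by (simp add: sub_path_def initial_def take_map)

lemma initial_le: "initial n x = initial n y \<Longrightarrow> j \<le> n \<Longrightarrow> initial j x = initial j y"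
  by (metis sub_path_initial)

lemma initial_psource: "x \<in> PB \<Longrightarrow> psource (initial n x) = erange (x n)"
  by (cases n) (auto simp: infinite_paths_def psource_def initial_def)

lemma initial_FB: assumes "x \<in> PB" shows "initial n x \<in> FB"
proof (induction n)
  case 0
  have "erange (x 0) \<in> Obj L" using assms
    by (auto simp: infinite_paths_def edge_level_def erange_def split_beta)
  then show ?case by (simp add: initial_def finite_paths_def)
next
  case (Suc n)
  have "x n \<in> out_edges n (erange (x n))" using assms by (auto simp: out_edges_def infinite_paths_def)
  then show ?case using Suc assms by (simp add: initial_Suc extend_FB_iff initial_psource)
qed

lemma cyl_PB: "cyl \<eta> \<subseteq> PB" by (auto simp: cylinder_def)

lemma cyl_sub: "x \<in> cyl \<gamma> \<Longrightarrow> j \<le> plength \<gamma> \<Longrightarrow> x \<in> cyl (sub_path \<gamma> j)"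
  using plength_sub_path sub_path_initial[of j "plength \<gamma>" x] by (fastforce simp: cylinder_def)

lemma cyl_extend: "x \<in> cyl (add_edge \<eta> e) \<longleftrightarrow> x \<in> cyl \<eta> \<and> x (plength \<eta>) = e"
  by (auto simp: cylinder_def initial_Suc)

lemma cyl_nth: assumes "\<eta> \<in> FB" "x \<in> cyl \<eta>"
  shows "x (plength \<eta>) \<in> out_edges (plength \<eta>) (psource \<eta>)"
proof -
  have x: "x \<in> PB" "initial (plength \<eta>) x = \<eta>" using assms by (auto simp: cylinder_def)
  show ?thesis using initial_FB[OF x(1), of "Suc (plength \<eta>)"] x assms
    by (simp add: initial_Suc extend_FB_iff)
qed

lemma cyl_Union: assumes "\<eta> \<in> FB"
  shows "cyl \<eta> = (\<Union>e\<in>out_edges (plength \<eta>) (psource \<eta>). cyl (add_edge \<eta> e))"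
  using cyl_nth[OF assms] by (auto simp: cyl_extend)

lemma cyl_same_length: "plength \<eta> = plength \<eta>' \<Longrightarrow> \<eta> \<noteq> \<eta>' \<Longrightarrow> cyl \<eta> \<inter> cyl \<eta>' = {}"
  by (auto simp: cylinder_def)

lemma ipath_eq: "(\<And>n. initial n x = initial n y) \<Longrightarrow> x = y"
  by (rule ext) (metis extend_inject initial_Suc)

lemma path_meet_eq_Some:
  assumes "x \<in> PB" "y \<in> PB" "x \<noteq> y"
  shows "path_meet x y = Some \<eta> \<longleftrightarrow> initial (plength \<eta>) x = \<eta> \<and> initial (plength \<eta>) y = \<eta> \<and>
     x (plength \<eta>) \<noteq> y (plength \<eta>)" (is "?l \<longleftrightarrow> ?r")
proof -
  obtain N where N: "initial N x \<noteq> initial N y" using ipath_eq assms by blast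
  have bnd: "n \<le> N" if "initial n x = initial n y" for n
    using that N initial_le by (meson nat_le_linear)
  show ?thesis
  proof
    assume ?l
    then have r: "erange (x 0) = erange (y 0)" by (auto simp: path_meet_def split: if_splits)
    define n where "n = (GREATEST n. initial n x = initial n y)"
    have "initial 0 x = initial 0 y" using r by (simp add: initial_def)
    then have n: "initial n x = initial n y" unfolding n_def
      using bnd by (rule GreatestI_nat)
    have n2: "initial (Suc n) x \<noteq> initial (Suc n) y"
    proof
      assume "initial (Suc n) x = initial (Suc n) y"
      then have "Suc n \<le> n" unfolding n_def
        by (rule Greatest_le_nat) (use bnd in auto)
      then show False by simp
    qed
    have "\<eta> = initial n x" using \<open>?l\<close> r by (simp add: path_meet_def n_def)
    then show ?r using n n2 by (auto simp: initial_Suc)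
  next
    assume r: ?r
    have "(GREATEST n. initial n x = initial n y) = plength \<eta>"
    proof (rule Greatest_equality)
      show "initial (plength \<eta>) x = initial (plength \<eta>) y" using r by simp
      fix n assume "initial n x = initial n y"
      then show "n \<le> plength \<eta>"
        using r initial_le[of n x y "Suc (plength \<eta>)"] by (force simp: initial_Suc)
    qed
    moreover have "erange (x 0) = erange (y 0)"
      using r by (metis initial_def prod.inject)
    ultimately show ?l using r by (simp add: path_meet_def)
  qed
qed

lemma branch_pairs_eq: assumes "\<eta> \<in> FB"
  shows "branch_pairs L \<eta> = (\<Union>(e, e')\<in>ext1 L \<eta>. cyl (add_edge \<eta> e) \<times> cyl (add_edge \<eta> e'))"
proof -
  have "(x, y) \<in> branch_pairs L \<eta> \<longleftrightarrow> x \<in> cyl \<eta> \<and> y \<in> cyl \<eta> \<and> x (plength \<eta>) \<noteq> y (plength \<eta>)" for x y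
  proof -
    have "x \<noteq> y" if "x (plength \<eta>) \<noteq> y (plength \<eta>)" using that by auto
    then show ?thesis
      by (cases "x \<in> PB \<and> y \<in> PB \<and> x \<noteq> y") (auto simp: branch_pairs_def path_meet_eq_Some cylinder_def)
  qed
  moreover have "(x, y) \<in> (\<Union>(e, e')\<in>ext1 L \<eta>. cyl (add_edge \<eta> e) \<times> cyl (add_edge \<eta> e')) \<longleftrightarrow>
    x \<in> cyl \<eta> \<and> y \<in> cyl \<eta> \<and> x (plength \<eta>) \<noteq> y (plength \<eta>)"
    (is "_ \<longleftrightarrow> ?r") for x y
  proof
    assume ?r
    then have "(x (plength \<eta>), y (plength \<eta>)) \<in> ext1 L \<eta>"
      using cyl_nth[OF assms] by (simp add: ext1_eq[OF assms])
    moreover have "x \<in> cyl (add_edge \<eta> (x (plength \<eta>)))" "y \<in> cyl (add_edge \<eta> (y (plength \<eta>)))"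
      using \<open>?r\<close> by (simp_all add: cyl_extend)
    ultimately show "(x, y) \<in> (\<Union>(e, e')\<in>ext1 L \<eta>. cyl (add_edge \<eta> e) \<times> cyl (add_edge \<eta> e'))"
      by blast
  qed (auto simp: ext1_eq[OF assms] cyl_extend)
  ultimately show ?thesis by (intro Set.set_eqI) (metis surj_pair)
qed

lemma FB_induct [consumes 1, case_names vertex add]:
  assumes "\<gamma> \<in> FB" and "\<And>v. v \<in> Obj L \<Longrightarrow> P (v, [])"
    and "\<And>\<eta> e. \<eta> \<in> FB \<Longrightarrow> e \<in> out_edges (plength \<eta>) (psource \<eta>) \<Longrightarrow> P \<eta> \<Longrightarrow> P (add_edge \<eta> e)"
  shows "P \<gamma>"
proof -
  have "P (sub_path \<gamma> j)" if "j \<le> plength \<gamma>" for j using that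
  proof (induction j)
    case 0
    then show ?case using assms(1,2) by (auto simp: sub_path_def finite_paths_def)
  next
    case (Suc j)
    have eq: "sub_path \<gamma> (Suc j) = add_edge (sub_path \<gamma> j) (snd \<gamma> ! j)"
      using Suc by (intro sub_path_Suc) auto
    show ?case unfolding eq
    proof (rule assms(3))
      show "sub_path \<gamma> j \<in> FB" by (rule sub_path_FB[OF assms(1)])
      show "snd \<gamma> ! j \<in> out_edges (plength (sub_path \<gamma> j)) (psource (sub_path \<gamma> j))"
        using sub_path_FB[OF assms(1)] eq by (metis extend_FB_iff)
    qed (use Suc in auto)
  qed
  from this[of "plength \<gamma>"] show ?thesis by (simp add: sub_path_all)
qed

definition Bset :: "(nat \<times> 'v) option \<Rightarrow> 'v edge set" where
  "Bset i = (case i of None \<Rightarrow> (\<lambda>v. (v, v, 0)) ` Obj L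
     | Some (n, p) \<Rightarrow> if p \<in> Obj L then out_edges n p else {undefined})"

definition Bwt :: "(nat \<times> 'v) option \<Rightarrow> 'v edge \<Rightarrow> real" where
  "Bwt i e = (case i of None \<Rightarrow> \<kappa> (esource e)
     | Some (n, p) \<Rightarrow> if p \<in> Obj L then \<kappa> (esource e) / (rho L (col n) * \<kappa> p) else 1)"

definition Bm :: "(nat \<times> 'v) option \<Rightarrow> 'v edge measure" where
  "Bm i = point_measure (Bset i) (\<lambda>e. ennreal (Bwt i e))"

lemma finite_Bset: "finite (Bset i)"
  by (auto simp: Bset_def finite_Obj finite_out split: option.splits)

lemma Bwt_nonneg: assumes "e \<in> Bset i" shows "Bwt i e \<ge> 0"
proof (cases i)
  case None
  then obtain v where "v \<in> Obj L" "e = (v, v, 0)" using assms by (auto simp: Bset_def)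
  then show ?thesis using None kappa_pos[of v] by (simp add: Bwt_def esource_def)
next
  case (Some a)
  obtain n p where a: "a = (n, p)" by force
  show ?thesis
  proof (cases "p \<in> Obj L")
    case True
    then have "esource e \<in> Obj L" using assms Some a by (auto simp: Bset_def intro: out_edges_Obj)
    from kappa_pos[OF this] kappa_pos[OF True] rho_pos[of n] show ?thesis
      using Some a True by (simp add: Bwt_def)
  qed (simp add: Some a Bwt_def)
qed

lemma Bwt_sum: "(\<Sum>e\<in>Bset i. Bwt i e) = 1"
proof (cases i)
  case None
  have "(\<Sum>e\<in>(\<lambda>v. (v, v, 0::nat)) ` Obj L. \<kappa> (esource e)) = (\<Sum>v\<in>Obj L. \<kappa> v)"
    by (subst sum.reindex) (auto simp: inj_on_def esource_def)
  then show ?thesis using None kappa_sum by (simp add: Bset_def Bwt_def)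
next
  case (Some a)
  obtain n p where a: "a = (n, p)" by force
  show ?thesis
  proof (cases "p \<in> Obj L")
    case True
    then show ?thesis using Some a out_sum[OF True, of n] rho_pos[of n] kappa_pos[OF True]
      by (simp add: Bset_def Bwt_def flip: sum_divide_distrib)
  qed (simp add: Some a Bset_def Bwt_def)
qed

lemma space_Bm: "space (Bm i) = Bset i" and sets_Bm: "sets (Bm i) = Pow (Bset i)"
  by (auto simp: Bm_def space_point_measure sets_point_measure)

lemma emeasure_Bm: "A \<subseteq> Bset i \<Longrightarrow> emeasure (Bm i) A = ennreal (\<Sum>e\<in>A. Bwt i e)"
  unfolding Bm_def using finite_Bset Bwt_nonneg
  by (subst emeasure_point_measure_finite) (auto simp: subset_iff intro!: sum_ennreal)

lemma prob_Bm: "prob_space (Bm i)"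
  by (rule prob_spaceI) (simp add: space_Bm emeasure_Bm Bwt_sum)

sublocale B: product_prob_space Bm UNIV
proof -
  interpret prob_space "Bm i" for i by (rule prob_Bm)
  show "product_prob_space Bm" by unfold_locales
qed

abbreviation "BP \<equiv> PiM UNIV Bm"

primrec walk :: "((nat \<times> 'v) option \<Rightarrow> 'v edge) \<Rightarrow> nat \<Rightarrow> 'v edge" where
  "walk \<omega> 0 = \<omega> (Some (0, esource (\<omega> None)))"
| "walk \<omega> (Suc n) = \<omega> (Some (Suc n, esource (walk \<omega> n)))"

lemma space_BP: "\<omega> \<in> space BP \<Longrightarrow> \<omega> i \<in> Bset i"
  by (auto simp: space_PiM space_Bm PiE_iff)

lemma BP_None: "\<omega> \<in> space BP \<Longrightarrow> \<exists>v\<in>Obj L. \<omega> None = (v, v, 0)"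
  using space_BP[of \<omega> None] by (auto simp: Bset_def)

lemma BP_Some: "\<omega> \<in> space BP \<Longrightarrow> p \<in> Obj L \<Longrightarrow> \<omega> (Some (n, p)) \<in> out_edges n p"
  using space_BP[of \<omega> "Some (n, p)"] by (auto simp: Bset_def)

lemma walk_out: assumes "\<omega> \<in> space BP"
  shows "walk \<omega> n \<in> out_edges n (case n of 0 \<Rightarrow> esource (\<omega> None) | Suc j \<Rightarrow> esource (walk \<omega> j))"
proof (induction n)
  case 0
  then show ?case using BP_None[OF assms] BP_Some[OF assms] by (auto simp: esource_def)
next
  case (Suc n)
  then have "esource (walk \<omega> n) \<in> Obj L" by (rule out_edges_Obj)
  then show ?case using BP_Some[OF assms] by auto
qed

lemma walk_PB: assumes "\<omega> \<in> space BP" shows "walk \<omega> \<in> PB"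
proof -
  have "walk \<omega> n \<in> edge_level L (Suc n)" for n
    using walk_out[OF assms, of n] by (auto simp: out_edges_def)
  moreover have "esource (walk \<omega> n) = erange (walk \<omega> (Suc n))" for n
    using walk_out[OF assms, of "Suc n"] by (auto simp: out_edges_def)
  ultimately show ?thesis by (auto simp: infinite_paths_def)
qed

lemma walk_idx: assumes "\<omega> \<in> space BP"
  shows "walk \<omega> n = \<omega> (Some (n, erange (walk \<omega> n)))"
proof (cases n)
  case 0
  have "erange (walk \<omega> 0) = esource (\<omega> None)"
    using walk_out[OF assms, of 0] by (auto simp: out_edges_def)
  then show ?thesis using 0 by simp
next
  case (Suc j)
  have "erange (walk \<omega> (Suc j)) = esource (walk \<omega> j)"
    using walk_out[OF assms, of "Suc j"] by (auto simp: out_edges_def)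
  then show ?thesis using Suc by simp
qed

definition Ev :: "'v fpath \<Rightarrow> ((nat \<times> 'v) option \<Rightarrow> 'v edge) \<Rightarrow> bool" where
  "Ev \<gamma> \<omega> \<longleftrightarrow> \<omega> None = (fst \<gamma>, fst \<gamma>, 0) \<and>
     (\<forall>j<plength \<gamma>. \<omega> (Some (j, erange (snd \<gamma> ! j))) = snd \<gamma> ! j)"

lemma Ev_add: "Ev (add_edge \<eta> e) \<omega> \<longleftrightarrow> Ev \<eta> \<omega> \<and> \<omega> (Some (plength \<eta>, erange e)) = e"
  by (auto simp: Ev_def add_edge_def plength_def nth_append less_Suc_eq)

lemma walk_cyl: assumes "\<gamma> \<in> FB" "\<omega> \<in> space BP"
  shows "walk \<omega> \<in> cyl \<gamma> \<longleftrightarrow> Ev \<gamma> \<omega>"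
  using assms(1)
proof (induction rule: FB_induct)
  case (vertex v)
  have "erange (walk \<omega> 0) = esource (\<omega> None)"
    using walk_out[OF assms(2), of 0] by (auto simp: out_edges_def)
  moreover have "\<omega> None = (v, v, 0) \<longleftrightarrow> esource (\<omega> None) = v"
    using BP_None[OF assms(2)] by (auto simp: esource_def)
  ultimately show ?case using walk_PB[OF assms(2)]
    by (simp add: cylinder_def plength_def initial_def Ev_def)
next
  case (add \<eta> e)
  have "walk \<omega> (plength \<eta>) = \<omega> (Some (plength \<eta>, erange e))" if "walk \<omega> \<in> cyl \<eta>"
  proof -
    have "erange (walk \<omega> (plength \<eta>)) = psource \<eta>"
      using that initial_psource[OF walk_PB[OF assms(2)], of "plength \<eta>"] by (simp add: cylinder_def)
    also have "\<dots> = erange e" using add by (auto simp: out_edges_def)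
    finally show ?thesis using walk_idx[OF assms(2), of "plength \<eta>"] by simp
  qed
  then show ?case using add.IH by (auto simp: cyl_extend Ev_add)
qed

lemma m_prod: "\<gamma> \<in> FB \<Longrightarrow>
   m \<gamma> = \<kappa> (fst \<gamma>) * (\<Prod>j<plength \<gamma>. Bwt (Some (j, erange (snd \<gamma> ! j))) (snd \<gamma> ! j))"
proof (induction rule: FB_induct)
  case (vertex v)
  then show ?case by (simp add: m_eq plength_def psource_def cfac_def)
next
  case (add \<eta> e)
  have e: "erange e = psource \<eta>" "psource \<eta> \<in> Obj L"
    using add by (auto simp: out_edges_def psource_Obj)
  have "(\<Prod>j<plength (add_edge \<eta> e). Bwt (Some (j, erange (snd (add_edge \<eta> e) ! j))) (snd (add_edge \<eta> e) ! j))
     = (\<Prod>j<plength \<eta>. Bwt (Some (j, erange (snd \<eta> ! j))) (snd \<eta> ! j)) * Bwt (Some (plength \<eta>, erange e)) e"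
    by (simp add: add_edge_def nth_append plength_def)
  then have "\<kappa> (fst (add_edge \<eta> e)) * (\<Prod>j<plength (add_edge \<eta> e).
       Bwt (Some (j, erange (snd (add_edge \<eta> e) ! j))) (snd (add_edge \<eta> e) ! j))
     = m \<eta> * Bwt (Some (plength \<eta>, erange e)) e"
    using add.IH by (simp add: add_edge_def)
  also have "\<dots> = m (add_edge \<eta> e)"
    using e kappa_pos[OF e(2)] by (simp add: Bwt_def m_eq cfac_def)
  finally show ?case ..
qed

lemma path_edge: assumes "\<gamma> \<in> FB" "j < plength \<gamma>"
  shows "snd \<gamma> ! j \<in> Bset (Some (j, erange (snd \<gamma> ! j)))"
proof -
  have "snd \<gamma> ! j \<in> edge_level L (Suc j)" using assms
    by (auto simp: finite_paths_def plength_def)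
  moreover from this have "erange (snd \<gamma> ! j) \<in> Obj L" by (auto simp: edge_level_def erange_def)
  ultimately show ?thesis by (simp add: Bset_def out_edges_def)
qed

lemma Ev_measure: assumes g: "\<gamma> \<in> FB"
  shows "emeasure BP {\<omega> \<in> space BP. Ev \<gamma> \<omega>} = ennreal (m \<gamma>)"
    and "{\<omega> \<in> space BP. Ev \<gamma> \<omega>} \<in> sets BP"
proof -
  let ?h = "\<lambda>j. Some (j, erange (snd \<gamma> ! j))"
  define J where "J = insert None (?h ` {..<plength \<gamma>})"
  define X where "X = (\<lambda>i :: (nat \<times> 'v) option. case i of None \<Rightarrow> {(fst \<gamma>, fst \<gamma>, 0::nat)} | Some (j, p) \<Rightarrow> {snd \<gamma> ! j})"
  have v: "fst \<gamma> \<in> Obj L" using g by (auto simp: finite_paths_def)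
  have XB: "X i \<subseteq> Bset i" if "i \<in> J" for i
    using that path_edge[OF g] v by (auto simp: J_def X_def Bset_def[of None])
  have Xs: "X i \<in> sets (Bm i)" if "i \<in> J" for i using XB[OF that] by (simp add: sets_Bm)
  have fJ: "finite J" by (simp add: J_def)
  have eq: "{\<omega> \<in> space BP. Ev \<gamma> \<omega>} = {\<omega> \<in> space BP. \<forall>i\<in>J. \<omega> i \<in> X i}"
    by (auto simp: Ev_def J_def X_def)
  show "{\<omega> \<in> space BP. Ev \<gamma> \<omega>} \<in> sets BP"
    unfolding eq
  proof (rule sets.sets_Collect_finite_All[OF _ fJ])
    fix i assume "i \<in> J"
    then have "{x \<in> space (Bm i). x \<in> X i} \<in> sets (Bm i)" using XB by (auto simp: sets_Bm space_Bm)
    then show "{\<omega> \<in> space BP. \<omega> i \<in> X i} \<in> sets BP" by (intro sets_Collect_single') auto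
  qed
  have "emeasure BP {\<omega> \<in> space BP. Ev \<gamma> \<omega>} = (\<Prod>i\<in>J. emeasure (Bm i) (X i))"
    unfolding eq using Xs fJ by (intro B.emeasure_PiM_Collect) auto
  also have "\<dots> = emeasure (Bm None) (X None) * (\<Prod>j<plength \<gamma>. emeasure (Bm (?h j)) (X (?h j)))"
    unfolding J_def by (subst prod.insert) (auto simp: prod.reindex inj_on_def)
  also have "emeasure (Bm None) (X None) = ennreal (\<kappa> (fst \<gamma>))"
    using XB[of None] by (subst emeasure_Bm) (auto simp: J_def X_def Bwt_def esource_def)
  also have "(\<Prod>j<plength \<gamma>. emeasure (Bm (?h j)) (X (?h j))) =
     (\<Prod>j<plength \<gamma>. ennreal (Bwt (?h j) (snd \<gamma> ! j)))"
    using path_edge[OF g] by (intro prod.cong refl, subst emeasure_Bm) (auto simp: X_def)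
  also have "\<dots> = ennreal (\<Prod>j<plength \<gamma>. Bwt (?h j) (snd \<gamma> ! j))"
    using Bwt_nonneg path_edge[OF g] by (intro prod_ennreal) auto
  also have "ennreal (\<kappa> (fst \<gamma>)) * \<dots> = ennreal (m \<gamma>)"
    unfolding m_prod[OF g]
    using kappa_pos[OF v] prod_nonneg[of "{..<plength \<gamma>}" "\<lambda>j. Bwt (?h j) (snd \<gamma> ! j)"]
      Bwt_nonneg[OF path_edge[OF g]]
    by (simp add: ennreal_mult)
  finally show "emeasure BP {\<omega> \<in> space BP. Ev \<gamma> \<omega>} = ennreal (m \<gamma>)" .
qed

lemma cyl_Pow: "cyl ` FB \<subseteq> Pow PB" using cyl_PB by auto

lemma space_M: "space M = PB" and sets_M: "sets M = sigma_sets PB (cyl ` FB)"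
  by (simp_all add: path_measure_def space_extend_measure[OF cyl_Pow] sets_extend_measure[OF cyl_Pow])

lemma walk_measurable: "walk \<in> measurable BP (sigma PB (cyl ` FB))"
proof (rule measurable_measure_of[OF cyl_Pow])
  show "walk \<in> space BP \<rightarrow> PB" using walk_PB by auto
  fix A assume "A \<in> cyl ` FB"
  then obtain \<gamma> where g: "\<gamma> \<in> FB" "A = cyl \<gamma>" by auto
  have "walk -` A \<inter> space BP = {\<omega> \<in> space BP. Ev \<gamma> \<omega>}"
    using walk_cyl[OF g(1)] g(2) by auto
  then show "walk -` A \<inter> space BP \<in> sets BP" using Ev_measure(2)[OF g(1)] by simp
qed

lemma emeasure_cyl: assumes g: "\<gamma> \<in> FB" shows "emeasure M (cyl \<gamma>) = ennreal (m \<gamma>)"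
proof -
  define N where "N = distr BP (sigma PB (cyl ` FB)) walk"
  have sN: "sets N = sets M" unfolding N_def sets_M using cyl_Pow by simp
  show ?thesis
  proof (rule emeasure_extend_measure[where \<mu>' = "emeasure N", OF path_measure_def _ cyl_Pow _ _ g])
    fix \<gamma> assume g: "\<gamma> \<in> FB"
    have "walk -` cyl \<gamma> \<inter> space BP = {\<omega> \<in> space BP. Ev \<gamma> \<omega>}" using walk_cyl[OF g] by auto
    then show "emeasure N (cyl \<gamma>) = ennreal (m \<gamma>)"
      unfolding N_def using g Ev_measure[OF g] cyl_Pow
      by (subst emeasure_distr[OF walk_measurable]) auto
  next
    show "positive (sets M) (emeasure N)" by (simp add: positive_def)
    show "countably_additive (sets M) (emeasure N)"
      unfolding sN[symmetric] by (rule emeasure_countably_additive)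
  qed
qed

lemma cyl_sets: "\<gamma> \<in> FB \<Longrightarrow> cyl \<gamma> \<in> sets M"
  unfolding sets_M by (intro sigma_sets.Basic) auto

lemma vertex_FB: "v \<in> Obj L \<Longrightarrow> (v, []) \<in> FB"
  by (simp add: finite_paths_def)

lemma PB_Union: "PB = (\<Union>v\<in>Obj L. cyl (v, []))"
  using initial_FB[of _ 0] by (auto simp: cylinder_def plength_def initial_def finite_paths_def)

lemma prob_M: "prob_space M"
proof (rule prob_spaceI)
  have "emeasure M (\<Union>v\<in>Obj L. cyl (v, [])) = (\<Sum>v\<in>Obj L. emeasure M (cyl (v, [])))"
    using finite_Obj cyl_sets[OF vertex_FB]
    by (intro sum_emeasure[symmetric]) (auto simp: disjoint_family_on_def cylinder_def plength_def)
  also have "\<dots> = (\<Sum>v\<in>Obj L. ennreal (\<kappa> v))"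
    using vertex_FB by (intro sum.cong refl, subst emeasure_cyl)
      (auto simp: m_eq cfac_def plength_def psource_def)
  also have "\<dots> = 1" using kappa_pos kappa_sum by (subst sum_ennreal) (auto intro: less_imp_le)
  finally show "emeasure M (space M) = 1" unfolding space_M PB_Union[symmetric] .
qed


lemma w_add: assumes "\<eta> \<in> FB" "e \<in> out_edges (plength \<eta>) (psource \<eta>)"
  shows "w (add_edge \<eta> e) \<le> rho L (col (plength \<eta>)) powr (1 - 1 / \<delta>) * w \<eta>"
proof -
  let ?p = "psource \<eta>" and ?n = "plength \<eta>"
  let ?r = "rho L (col ?n)"
  have p: "?p \<in> Obj L" by (rule psource_Obj[OF assms(1)])
  have "\<kappa> (esource e) \<le> (\<Sum>e\<in>out_edges ?n ?p. \<kappa> (esource e))"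
    using assms(2) finite_out[OF p] out_edges_Obj kappa_pos
    by (intro member_le_sum) (auto intro: less_imp_le)
  also have "\<dots> = ?r * \<kappa> ?p" by (rule out_sum[OF p])
  finally have k: "\<kappa> (esource e) \<le> ?r * \<kappa> ?p" .
  have "w (add_edge \<eta> e) = cfac ?n powr (- 1 / \<delta>) * ?r powr (- 1 / \<delta>) * \<kappa> (esource e)"
    using cfac_pos[of ?n] rho_pos[of ?n] by (simp add: w_eq cfac_def powr_mult)
  also have "\<dots> \<le> cfac ?n powr (- 1 / \<delta>) * ?r powr (- 1 / \<delta>) * (?r * \<kappa> ?p)"
    using k by (intro mult_left_mono) auto
  also have "\<dots> = (?r powr (- 1 / \<delta>) * ?r powr 1) * w \<eta>"
    using rho_pos[of ?n] by (simp add: w_eq)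
  also have "\<dots> = ?r powr (1 - 1 / \<delta>) * w \<eta>"
    by (subst powr_add[symmetric]) simp
  finally show ?thesis .
qed

lemma rho_powr_lt1: "rho L (col n) powr (1 - 1 / \<delta>) < 1"
proof -
  have "1 - 1 / \<delta> < 0" using delta by (simp add: field_simps)
  then show ?thesis using rho_col[of n] powr_less_mono[of "1 - 1 / \<delta>" 0] by simp
qed

lemma initial_out: "x \<in> PB \<Longrightarrow> x n \<in> out_edges (plength (initial n x)) (psource (initial n x))"
  using cyl_nth[OF initial_FB, of x x n] by (simp add: cylinder_def)

lemma w_initial_mono: assumes "x \<in> PB" "j \<le> n" shows "w (initial n x) \<le> w (initial j x)"
  using assms(2)
proof (induction rule: dec_induct)
  case (step n)
  have "w (initial (Suc n) x) \<le> rho L (col n) powr (1 - 1 / \<delta>) * w (initial n x)"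
    using w_add[OF initial_FB[OF assms(1)] initial_out[OF assms(1)], of n] by (simp add: initial_Suc)
  also have "\<dots> \<le> 1 * w (initial n x)"
    using rho_powr_lt1[of n] w_pos[OF initial_FB[OF assms(1)], of n] by (intro mult_right_mono) auto
  finally show ?case using step by simp
qed simp

lemma cyl_nonempty: assumes "\<eta> \<in> FB" shows "cyl \<eta> \<noteq> {}"
  using emeasure_cyl[OF assms] m_pos[OF assms] by (auto simp: ennreal_eq_0_iff)

lemma ext1_ne: assumes e: "\<eta> \<in> FB" shows "ext1 L \<eta> \<noteq> {}"
proof
  assume em: "ext1 L \<eta> = {}"
  let ?n = "plength \<eta>"
  let ?B = "rho L (col ?n) powr (1 - 1 / \<delta>) * w \<eta>"
  have B: "path_dist L \<kappa> \<delta> x y \<le> ?B" if x: "x \<in> cyl \<eta>" and y: "y \<in> cyl \<eta>" for x y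
  proof (cases "x = y")
    case True
    then show ?thesis using w_pos[OF e] by (simp add: path_dist_def)
  next
    case False
    have PB: "x \<in> PB" "y \<in> PB" and ini: "initial ?n x = \<eta>" "initial ?n y = \<eta>"
      using x y by (auto simp: cylinder_def)
    have "erange (x 0) = erange (y 0)" using ini by (metis initial_def prod.inject)
    then obtain \<zeta> where z: "path_meet x y = Some \<zeta>" by (auto simp: path_meet_def)
    note zz = z[unfolded path_meet_eq_Some[OF PB False]]
    have "\<not> plength \<zeta> < ?n"
    proof
      assume "plength \<zeta> < ?n"
      then have "initial (Suc (plength \<zeta>)) x = initial (Suc (plength \<zeta>)) y"
        using ini initial_le[of ?n x y "Suc (plength \<zeta>)"] by simp
      then show False using zz by (simp add: initial_Suc)
    qed
    moreover have "plength \<zeta> \<noteq> ?n"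
    proof
      assume eq: "plength \<zeta> = ?n"
      then have "(x ?n, y ?n) \<in> ext1 L \<eta>"
        using zz cyl_nth[OF e x] cyl_nth[OF e y] by (simp add: ext1_eq[OF e])
      then show False using em by simp
    qed
    ultimately have len: "Suc ?n \<le> plength \<zeta>" by simp
    have "path_dist L \<kappa> \<delta> x y = w \<zeta>" using False z by (simp add: path_dist_def)
    also have "\<zeta> = initial (plength \<zeta>) x" using zz by simp
    also have "w (initial (plength \<zeta>) x) \<le> w (initial (Suc ?n) x)"
      by (rule w_initial_mono[OF PB(1) len])
    also have "\<dots> \<le> ?B"
      using w_add[OF e cyl_nth[OF e x]] ini by (simp add: initial_Suc)
    finally show ?thesis .
  qed
  obtain x where "x \<in> cyl \<eta>" using cyl_nonempty[OF e] by auto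
  then have "cylinder_diam L \<kappa> \<delta> \<eta> \<le> ?B"
    unfolding cylinder_diam_def using B by (intro cSup_least) auto
  also have "?B < w \<eta>" using rho_powr_lt1[of ?n] w_pos[OF e] by simp
  finally show False using diam[OF e] by simp
qed

lemma finite_ext1: assumes "\<eta> \<in> FB" shows "finite (ext1 L \<eta>)"
proof -
  let ?O = "out_edges (plength \<eta>) (psource \<eta>)"
  have "ext1 L \<eta> \<subseteq> ?O \<times> ?O" by (auto simp: ext1_eq[OF assms])
  then show ?thesis using finite_out[OF psource_Obj[OF assms]] by (meson finite_SigmaI finite_subset)
qed

lemma ext1_FB: "z \<in> ext1 L \<eta> \<Longrightarrow> add_edge \<eta> (fst z) \<in> FB \<and> add_edge \<eta> (snd z) \<in> FB"
  by (auto simp: ext1_def)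

lemma ext_mass_pos: assumes "\<eta> \<in> FB" shows "ext_mass L \<kappa> \<eta> > 0"
  unfolding ext_mass_def case_prod_beta
proof (rule sum_pos[OF finite_ext1[OF assms] ext1_ne[OF assms]])
  fix z assume "z \<in> ext1 L \<eta>"
  from ext1_FB[OF this] show "0 < m (add_edge \<eta> (fst z)) * m (add_edge \<eta> (snd z))"
    by (intro mult_pos_pos m_pos) auto
qed

sublocale P: prob_space M by (rule prob_M)
sublocale PP: pair_prob_space M M by unfold_locales

lemma measure_cyl: "\<eta> \<in> FB \<Longrightarrow> measure M (cyl \<eta>) = m \<eta>"
  using emeasure_cyl m_pos[of \<eta>] by (simp add: measure_def)

lemma branch_pairs_sets: assumes "\<eta> \<in> FB" shows "branch_pairs L \<eta> \<in> sets (M \<Otimes>\<^sub>M M)"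
  unfolding branch_pairs_eq[OF assms] using finite_ext1[OF assms]
  by (intro sets.finite_UN) (auto simp: ext1_def intro!: pair_measureI cyl_sets)

lemma emeasure_branch_pairs: assumes e: "\<eta> \<in> FB"
  shows "emeasure (M \<Otimes>\<^sub>M M) (branch_pairs L \<eta>) = ennreal (ext_mass L \<kappa> \<eta>)"
proof -
  let ?C = "\<lambda>z. cyl (add_edge \<eta> (fst z)) \<times> cyl (add_edge \<eta> (snd z))"
  have F: "add_edge \<eta> (fst z) \<in> FB" "add_edge \<eta> (snd z) \<in> FB" if "z \<in> ext1 L \<eta>" for z
    using that by (auto simp: ext1_def)
  have "emeasure (M \<Otimes>\<^sub>M M) (\<Union>z\<in>ext1 L \<eta>. ?C z) = (\<Sum>z\<in>ext1 L \<eta>. emeasure (M \<Otimes>\<^sub>M M) (?C z))"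
  proof (rule sum_emeasure[symmetric])
    show "?C ` ext1 L \<eta> \<subseteq> sets (M \<Otimes>\<^sub>M M)" by (intro image_subsetI pair_measureI cyl_sets F)
    show "finite (ext1 L \<eta>)" by (rule finite_ext1[OF e])
    show "disjoint_family_on ?C (ext1 L \<eta>)"
      unfolding disjoint_family_on_def by (auto simp: cyl_extend)
  qed
  also have "\<dots> = (\<Sum>z\<in>ext1 L \<eta>. ennreal (m (add_edge \<eta> (fst z)) * m (add_edge \<eta> (snd z))))"
  proof (rule sum.cong[OF refl])
    fix z assume z: "z \<in> ext1 L \<eta>"
    have "emeasure (M \<Otimes>\<^sub>M M) (?C z) =
        emeasure M (cyl (add_edge \<eta> (fst z))) * emeasure M (cyl (add_edge \<eta> (snd z)))"
      using F[OF z] by (intro P.emeasure_pair_measure_Times cyl_sets)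
    then show "emeasure (M \<Otimes>\<^sub>M M) (?C z) = ennreal (m (add_edge \<eta> (fst z)) * m (add_edge \<eta> (snd z)))"
      using F[OF z] m_pos[OF F(1)[OF z]] by (simp add: emeasure_cyl ennreal_mult')
  qed
  also have "\<dots> = ennreal (ext_mass L \<kappa> \<eta>)"
    unfolding ext_mass_def case_prod_beta
    by (intro sum_ennreal less_imp_le mult_pos_pos m_pos F)
  finally show ?thesis unfolding branch_pairs_eq[OF e] by (simp add: case_prod_beta)
qed

lemma space_branch: "\<eta> \<in> FB \<Longrightarrow> space (branch_measure L \<kappa> \<eta>) = branch_pairs L \<eta>"
  using sets.sets_into_space[OF branch_pairs_sets, of \<eta>]
  by (simp add: branch_measure_def space_scale_measure space_restrict_space Int_absorb2)

lemma prob_branch: assumes e: "\<eta> \<in> FB" shows "prob_space (branch_measure L \<kappa> \<eta>)"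
proof (rule prob_spaceI)
  have "emeasure (restrict_space (M \<Otimes>\<^sub>M M) (branch_pairs L \<eta>)) (branch_pairs L \<eta>) = ennreal (ext_mass L \<kappa> \<eta>)"
    using branch_pairs_sets[OF e] sets.sets_into_space[OF branch_pairs_sets[OF e]]
    by (subst emeasure_restrict_space) (auto simp: emeasure_branch_pairs[OF e] Int_absorb2)
  then show "emeasure (branch_measure L \<kappa> \<eta>) (space (branch_measure L \<kappa> \<eta>)) = 1"
    unfolding space_branch[OF e] using ext_mass_pos[OF e]
    by (simp add: branch_measure_def flip: ennreal_mult')
qed

lemma scale_measure_density: "scale_measure (ennreal c) N = density N (\<lambda>_. ennreal c)"
  by (rule measure_eqI) (auto simp: emeasure_density nn_integral_cmult_indicator)

lemma integral_branch:
  fixes h :: "'v ipath \<times> 'v ipath \<Rightarrow> complex"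
  assumes e: "\<eta> \<in> FB" and h: "h \<in> borel_measurable (M \<Otimes>\<^sub>M M)"
  shows "integral\<^sup>L (branch_measure L \<kappa> \<eta>) h =
     (\<integral>z. indicator (branch_pairs L \<eta>) z * h z \<partial>(M \<Otimes>\<^sub>M M)) / of_real (ext_mass L \<kappa> \<eta>)"
proof -
  let ?R = "restrict_space (M \<Otimes>\<^sub>M M) (branch_pairs L \<eta>)"
  have sp: "branch_pairs L \<eta> \<inter> space (M \<Otimes>\<^sub>M M) \<in> sets (M \<Otimes>\<^sub>M M)"
    using branch_pairs_sets[OF e] by auto
  have "integral\<^sup>L (branch_measure L \<kappa> \<eta>) h = (\<integral>z. (1 / ext_mass L \<kappa> \<eta>) *\<^sub>R h z \<partial>?R)"
    unfolding branch_measure_def scale_measure_density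
    using ext_mass_pos[OF e] measurable_restrict_space1[OF h]
    by (subst integral_density) auto
  also have "\<dots> = (\<integral>z. h z \<partial>?R) / of_real (ext_mass L \<kappa> \<eta>)"
    by (subst integral_scaleR_right) (simp add: scaleR_conv_of_real)
  also have "(\<integral>z. h z \<partial>?R) = (\<integral>z. indicator (branch_pairs L \<eta>) z *\<^sub>R h z \<partial>(M \<Otimes>\<^sub>M M))"
    by (rule integral_restrict_space[OF sp])
  also have "\<dots> = (\<integral>z. indicator (branch_pairs L \<eta>) z * h z \<partial>(M \<Otimes>\<^sub>M M))"
    by (intro Bochner_Integration.integral_cong refl) (simp add: indicator_def)
  finally show ?thesis .
qed

definition bmf :: "('v ipath \<Rightarrow> complex) \<Rightarrow> bool" where
  "bmf u \<longleftrightarrow> u \<in> borel_measurable M \<and> (\<exists>B. \<forall>x. cmod (u x) \<le> B)"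

lemma bmf_measurable[measurable_dest]: "bmf u \<Longrightarrow> u \<in> borel_measurable M" by (simp add: bmf_def)

lemma bmf_const: "bmf (\<lambda>x. c)" by (auto simp: bmf_def)

lemma bmf_ind: "A \<in> sets M \<Longrightarrow> bmf (indicator A)"
  by (auto simp: bmf_def indicator_def intro!: exI[of _ 1])

lemma bmf_mult: assumes "bmf u" "bmf v" shows "bmf (\<lambda>x. u x * v x)"
proof -
  obtain B C where "\<And>x. cmod (u x) \<le> B" "\<And>x. cmod (v x) \<le> C" using assms by (auto simp: bmf_def)
  then have "cmod (u x * v x) \<le> B * C" for x
    unfolding norm_mult by (intro mult_mono) (auto intro: order_trans[OF norm_ge_zero])
  then show ?thesis using assms by (auto simp: bmf_def)
qed

lemma bmf_add: assumes "bmf u" "bmf v" shows "bmf (\<lambda>x. u x + v x)"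
proof -
  obtain B C where "\<And>x. cmod (u x) \<le> B" "\<And>x. cmod (v x) \<le> C" using assms by (auto simp: bmf_def)
  then have "cmod (u x + v x) \<le> B + C" for x by (meson add_mono norm_triangle_ineq order_trans)
  then show ?thesis using assms by (auto simp: bmf_def)
qed

lemma bmf_sum: "finite S \<Longrightarrow> (\<And>i. i \<in> S \<Longrightarrow> bmf (u i)) \<Longrightarrow> bmf (\<lambda>x. \<Sum>i\<in>S. u i x)"
  by (induction S rule: finite_induct) (auto intro: bmf_const bmf_add)

lemma bmf_integrable: assumes "bmf u" shows "integrable M u"
proof -
  obtain B where "\<And>x. cmod (u x) \<le> B" using assms by (auto simp: bmf_def)
  then show ?thesis using assms by (intro P.integrable_const_bound[of _ B]) auto
qed

lemma bmf_square: assumes "bmf u" shows "square_integrable M u"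
proof -
  obtain B where B: "\<And>x. cmod (u x) \<le> B" using assms by (auto simp: bmf_def)
  have "u \<in> borel_measurable M" using assms by auto
  moreover have "integrable M (\<lambda>x. (cmod (u x))\<^sup>2)"
    using B assms by (intro P.integrable_const_bound[of _ "B\<^sup>2"]) (auto intro!: power_mono)
  ultimately show ?thesis by (simp add: square_integrable_def)
qed

lemma form_domain_bmf: "g \<in> form_domain L \<Longrightarrow> bmf g"
  by (auto simp: form_domain_def intro!: bmf_sum bmf_mult[OF bmf_const] bmf_ind cyl_sets)

lemma bmf_prod: assumes "bmf u" "bmf v"
  shows "integrable (M \<Otimes>\<^sub>M M) (\<lambda>z. u (fst z) * v (snd z))"
    and "(\<integral>z. u (fst z) * v (snd z) \<partial>(M \<Otimes>\<^sub>M M)) = (\<integral>x. u x \<partial>M) * (\<integral>x. v x \<partial>M)"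
proof -
  obtain B C where "\<And>x. cmod (u x) \<le> B" "\<And>x. cmod (v x) \<le> C" using assms by (auto simp: bmf_def)
  then have b: "cmod (u x * v y) \<le> B * C" for x y
    unfolding norm_mult by (intro mult_mono) (auto intro: order_trans[OF norm_ge_zero])
  have [measurable]: "u \<in> borel_measurable M" "v \<in> borel_measurable M" using assms by auto
  show i: "integrable (M \<Otimes>\<^sub>M M) (\<lambda>z. u (fst z) * v (snd z))"
    using b by (intro PP.integrable_const_bound[of _ "B * C"]) auto
  have "(\<integral>x. (\<integral>y. u x * v y \<partial>M) \<partial>M) = (\<integral>z. u (fst z) * v (snd z) \<partial>(M \<Otimes>\<^sub>M M))"
    using PP.integral_fst'[OF i] by simp
  then show "(\<integral>z. u (fst z) * v (snd z) \<partial>(M \<Otimes>\<^sub>M M)) = (\<integral>x. u x \<partial>M) * (\<integral>x. v x \<partial>M)"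
    by simp
qed

definition IA :: "'v ipath set \<Rightarrow> ('v ipath \<Rightarrow> complex) \<Rightarrow> complex" where
  "IA A u = (\<integral>x. indicator A x * u x \<partial>M)"

lemma IA_square:
  assumes A: "A \<in> sets M" and f: "bmf f" and g: "bmf g"
  shows "integrable (M \<Otimes>\<^sub>M M) (\<lambda>z. (indicator A (fst z) * indicator A (snd z)) *
        ((f (fst z) - f (snd z)) * (g (fst z) - g (snd z))))" (is "integrable _ ?h")
    and "(\<integral>z. (indicator A (fst z) * indicator A (snd z)) *
        ((f (fst z) - f (snd z)) * (g (fst z) - g (snd z))) \<partial>(M \<Otimes>\<^sub>M M))
      = 2 * (of_real (measure M A) * IA A (\<lambda>x. f x * g x) - IA A f * IA A g)"
proof -
  note a = bmf_ind[OF A]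
  have af: "bmf (\<lambda>x. indicator A x * f x)" and ag: "bmf (\<lambda>x. indicator A x * g x)"
    and afg: "bmf (\<lambda>x. indicator A x * (f x * g x))"
    using a f g by (auto intro!: bmf_mult)
  have eq: "?h = (\<lambda>z. ((indicator A (fst z) * (f (fst z) * g (fst z))) * indicator A (snd z)
      + indicator A (fst z) * (indicator A (snd z) * (f (snd z) * g (snd z))))
      - ((indicator A (fst z) * f (fst z)) * (indicator A (snd z) * g (snd z))
      + (indicator A (fst z) * g (fst z)) * (indicator A (snd z) * f (snd z))))"
    by (rule ext) (simp add: algebra_simps)
  note p = bmf_prod[OF afg a] bmf_prod[OF a afg] bmf_prod[OF af ag] bmf_prod[OF ag af]
  show "integrable (M \<Otimes>\<^sub>M M) ?h" unfolding eq using p by (intro Bochner_Integration.integrable_add Bochner_Integration.integrable_diff)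
  have m1: "(\<integral>x. indicator A x \<partial>M) = complex_of_real (measure M A)"
  proof -
    have "(\<integral>x. indicator A x \<partial>M) = (\<integral>x. complex_of_real (indicator A x) \<partial>M)"
      by (intro Bochner_Integration.integral_cong) (auto simp: indicator_def)
    also have "\<dots> = complex_of_real (\<integral>x. indicator A x \<partial>M)" by (rule integral_complex_of_real)
    also have "(\<integral>x. indicator A x \<partial>M) = measure M A"
      using sets.sets_into_space[OF A] by (simp add: Int_absorb2)
    finally show ?thesis .
  qed
  show "integral\<^sup>L (M \<Otimes>\<^sub>M M) ?h = 2 * (of_real (measure M A) * IA A (\<lambda>x. f x * g x) - IA A f * IA A g)"
    unfolding eq using p
    by (simp add: Bochner_Integration.integral_add Bochner_Integration.integral_diff IA_def m1)
qed


lemma trace_block: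
  assumes e: "\<eta> \<in> FB"
  shows "Determinants.trace (abs_D_powr_block L \<kappa> \<delta> (- s) \<eta> **
       map_matrix cnj (Finite_Cartesian_Product.transpose (commutator_block L \<kappa> \<delta> \<phi> f \<eta>)) **
       commutator_block L \<kappa> \<delta> \<phi> g \<eta>) =
     of_real (2 * (1 / w \<eta>) powr (2 - s)) *
       (cnj (f (fst (\<phi> \<eta>)) - f (snd (\<phi> \<eta>))) * (g (fst (\<phi> \<eta>)) - g (snd (\<phi> \<eta>))))"
proof -
  have c: "(1 / w \<eta>) powr (2 - s) = (1 / w \<eta>) powr (- s) * (1 / w \<eta>) * (1 / w \<eta>)"
    using w_pos[OF e] by (simp add: powr_diff powr_minus divide_simps power2_eq_square)
  define u where "u = complex_of_real (1 / w \<eta>)"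
  define p where "p = complex_of_real ((1 / w \<eta>) powr (- s))"
  have c': "complex_of_real (2 * (1 / w \<eta>) powr (2 - s)) = 2 * p * u * u"
    unfolding c u_def p_def by simp
  show ?thesis
    unfolding c' commutator_block_def abs_D_powr_block_def D_block_def pi_block_def Let_def
      u_def[symmetric] p_def[symmetric]
    by (simp add: Determinants.trace_def sum_2 matrix_matrix_mult_def map_matrix_def
        Finite_Cartesian_Product.transpose_def Finite_Cartesian_Product.mat_def)
      (simp add: u_def algebra_simps)
qed

definition diffp :: "('v ipath \<Rightarrow> complex) \<Rightarrow> ('v ipath \<Rightarrow> complex) \<Rightarrow> 'v ipath \<times> 'v ipath \<Rightarrow> complex" where
  "diffp f g z = cnj (f (fst z) - f (snd z)) * (g (fst z) - g (snd z))"

definition coef :: "'v fpath \<Rightarrow> real" where "coef \<eta> = 2 * (1 / w \<eta>) powr (2 - s)"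

lemma form_eq: "dirichlet_form L \<kappa> \<delta> s f g =
   1 / 2 * (\<integral>\<phi>. (\<Sum>\<^sub>\<infinity>\<eta>\<in>FB. of_real (coef \<eta>) * diffp f g (\<phi> \<eta>)) \<partial>choice_measure L \<kappa>)"
  unfolding dirichlet_form_def
  by (intro arg_cong2[where f=times] refl Bochner_Integration.integral_cong infsum_cong)
    (simp add: trace_block diffp_def coef_def)

lemma form_zero: "dirichlet_form L \<kappa> \<delta> s (\<lambda>x. f x - f x) g = 0"
  and form_zero': "dirichlet_form L \<kappa> \<delta> s (\<lambda>x. 0) g = 0"
  unfolding form_eq by (simp_all add: diffp_def)

lemma space_choice: "\<phi> \<in> space (choice_measure L \<kappa>) \<Longrightarrow> \<eta> \<in> FB \<Longrightarrow> \<phi> \<eta> \<in> branch_pairs L \<eta>"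
  by (auto simp: choice_measure_def space_PiM PiE_iff space_branch)

lemma measurable_branch: "\<eta> \<in> FB \<Longrightarrow> h \<in> borel_measurable (M \<Otimes>\<^sub>M M) \<Longrightarrow> h \<in> borel_measurable (branch_measure L \<kappa> \<eta>)"
  unfolding branch_measure_def by (simp add: measurable_restrict_space1 cong: measurable_cong_sets)

lemma choice_integral:
  fixes h :: "'v ipath \<times> 'v ipath \<Rightarrow> complex"
  assumes e: "\<eta> \<in> FB" and h: "h \<in> borel_measurable (M \<Otimes>\<^sub>M M)" and B: "\<And>z. cmod (h z) \<le> B"
  shows "integrable (choice_measure L \<kappa>) (\<lambda>\<phi>. h (\<phi> \<eta>))"
    and "(\<integral>\<phi>. h (\<phi> \<eta>) \<partial>choice_measure L \<kappa>) =
     (\<integral>z. indicator (branch_pairs L \<eta>) z * h z \<partial>(M \<Otimes>\<^sub>M M)) / of_real (ext_mass L \<kappa> \<eta>)"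
proof -
  interpret C: prob_space "choice_measure L \<kappa>"
    unfolding choice_measure_def by (intro prob_space_PiM prob_branch)
  have [measurable]: "h \<in> borel_measurable (branch_measure L \<kappa> \<eta>)" by (rule measurable_branch[OF e h])
  have c: "(\<lambda>\<phi>. \<phi> \<eta>) \<in> measurable (choice_measure L \<kappa>) (branch_measure L \<kappa> \<eta>)"
    unfolding choice_measure_def by (rule measurable_component_singleton[OF e])
  show "integrable (choice_measure L \<kappa>) (\<lambda>\<phi>. h (\<phi> \<eta>))"
    using B measurable_compose[OF c, of h borel] by (intro C.integrable_const_bound[of _ B]) auto
  have "distr (choice_measure L \<kappa>) (branch_measure L \<kappa> \<eta>) (\<lambda>\<phi>. \<phi> \<eta>) = branch_measure L \<kappa> \<eta>"
    unfolding choice_measure_def using prob_branch e by (intro distr_PiM_component)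
  then have "(\<integral>\<phi>. h (\<phi> \<eta>) \<partial>choice_measure L \<kappa>) = integral\<^sup>L (branch_measure L \<kappa> \<eta>) h"
    using integral_distr[OF c, of h] by simp
  then show "(\<integral>\<phi>. h (\<phi> \<eta>) \<partial>choice_measure L \<kappa>) =
     (\<integral>z. indicator (branch_pairs L \<eta>) z * h z \<partial>(M \<Otimes>\<^sub>M M)) / of_real (ext_mass L \<kappa> \<eta>)"
    by (simp add: integral_branch[OF e h])
qed

lemma branch_pairs_iff: assumes e: "\<eta> \<in> FB"
  shows "z \<in> branch_pairs L \<eta> \<longleftrightarrow> fst z \<in> cyl \<eta> \<and> snd z \<in> cyl \<eta> \<and> fst z (plength \<eta>) \<noteq> snd z (plength \<eta>)"
proof
  assume "z \<in> branch_pairs L \<eta>"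
  then show "fst z \<in> cyl \<eta> \<and> snd z \<in> cyl \<eta> \<and> fst z (plength \<eta>) \<noteq> snd z (plength \<eta>)"
    unfolding branch_pairs_eq[OF e] by (auto simp: cyl_extend ext1_def)
next
  assume a: "fst z \<in> cyl \<eta> \<and> snd z \<in> cyl \<eta> \<and> fst z (plength \<eta>) \<noteq> snd z (plength \<eta>)"
  then have "(fst z (plength \<eta>), snd z (plength \<eta>)) \<in> ext1 L \<eta>"
    using cyl_nth[OF e] by (simp add: ext1_eq[OF e])
  moreover have "z \<in> cyl (add_edge \<eta> (fst z (plength \<eta>))) \<times> cyl (add_edge \<eta> (snd z (plength \<eta>)))"
    using a by (cases z) (simp add: cyl_extend)
  ultimately show "z \<in> branch_pairs L \<eta>" unfolding branch_pairs_eq[OF e] by blast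
qed

lemma indicator_branch: assumes e: "\<eta> \<in> FB"
  shows "(indicator (branch_pairs L \<eta>) z :: complex) =
     indicator (cyl \<eta>) (fst z) * indicator (cyl \<eta>) (snd z) -
     (\<Sum>a\<in>out_edges (plength \<eta>) (psource \<eta>).
        indicator (cyl (add_edge \<eta> a)) (fst z) * indicator (cyl (add_edge \<eta> a)) (snd z))"
proof -
  let ?n = "plength \<eta>" and ?O = "out_edges (plength \<eta>) (psource \<eta>)"
  let ?t = "\<lambda>a. (indicator (cyl (add_edge \<eta> a)) (fst z) * indicator (cyl (add_edge \<eta> a)) (snd z) :: complex)"
  have "?t a = (if a = fst z ?n then indicator (cyl \<eta>) (fst z) * indicator (cyl \<eta>) (snd z) *
      of_bool (fst z ?n = snd z ?n) else 0)" for a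
    by (auto simp: indicator_def cyl_extend)
  then have "(\<Sum>a\<in>?O. ?t a) = (if fst z ?n \<in> ?O then indicator (cyl \<eta>) (fst z) * indicator (cyl \<eta>) (snd z) *
      of_bool (fst z ?n = snd z ?n) else 0)"
    using finite_out[OF psource_Obj[OF e]] by simp
  then show ?thesis using cyl_nth[OF e, of "fst z"]
    by (auto simp: indicator_def branch_pairs_iff[OF e])
qed

definition sqd :: "'v ipath set \<Rightarrow> ('v ipath \<Rightarrow> complex) \<Rightarrow> ('v ipath \<Rightarrow> complex) \<Rightarrow> complex" where
  "sqd A f g = of_real (measure M A) * IA A (\<lambda>x. f x * g x) - IA A f * IA A g"

lemma branch_integral:
  assumes e: "\<eta> \<in> FB" and f: "bmf f" and g: "bmf g" and re: "\<And>x. cnj (f x) = f x"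
  shows "(\<integral>z. indicator (branch_pairs L \<eta>) z * diffp f g z \<partial>(M \<Otimes>\<^sub>M M)) =
    2 * (sqd (cyl \<eta>) f g - (\<Sum>a\<in>out_edges (plength \<eta>) (psource \<eta>). sqd (cyl (add_edge \<eta> a)) f g))"
proof -
  let ?O = "out_edges (plength \<eta>) (psource \<eta>)"
  let ?h = "\<lambda>A z. (indicator A (fst z) * indicator A (snd z)) *
        ((f (fst z) - f (snd z)) * (g (fst z) - g (snd z)))"
  have cs: "cyl \<eta> \<in> sets M" "\<And>a. a \<in> ?O \<Longrightarrow> cyl (add_edge \<eta> a) \<in> sets M"
    using cyl_sets e extend_FB_iff[OF e] by auto
  have "(\<lambda>z. indicator (branch_pairs L \<eta>) z * diffp f g z) =
     (\<lambda>z. ?h (cyl \<eta>) z - (\<Sum>a\<in>?O. ?h (cyl (add_edge \<eta> a)) z))"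
    by (rule ext) (simp add: indicator_branch[OF e] diffp_def re left_diff_distrib sum_distrib_right)
  then have "(\<integral>z. indicator (branch_pairs L \<eta>) z * diffp f g z \<partial>(M \<Otimes>\<^sub>M M)) =
     (\<integral>z. ?h (cyl \<eta>) z - (\<Sum>a\<in>?O. ?h (cyl (add_edge \<eta> a)) z) \<partial>(M \<Otimes>\<^sub>M M))" by simp
  also have "\<dots> = (\<integral>z. ?h (cyl \<eta>) z \<partial>(M \<Otimes>\<^sub>M M)) - (\<Sum>a\<in>?O. \<integral>z. ?h (cyl (add_edge \<eta> a)) z \<partial>(M \<Otimes>\<^sub>M M))"
    using IA_square(1)[OF _ f g] cs
    by (subst Bochner_Integration.integral_diff)
      (auto intro!: Bochner_Integration.integral_sum Bochner_Integration.integrable_sum)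
  also have "\<dots> = 2 * sqd (cyl \<eta>) f g - (\<Sum>a\<in>?O. 2 * sqd (cyl (add_edge \<eta> a)) f g)"
    unfolding sqd_def using IA_square(2)[OF _ f g] cs by simp
  finally show ?thesis by (simp add: sum_distrib_left right_diff_distrib)
qed

lemma IA_cong: "(\<And>x. x \<in> A \<Longrightarrow> u x = v x) \<Longrightarrow> IA A u = IA A v"
  unfolding IA_def by (intro Bochner_Integration.integral_cong) (auto simp: indicator_def)

lemma IA_support: "(\<And>x. x \<notin> A \<Longrightarrow> u x = 0) \<Longrightarrow> IA A u = (\<integral>x. u x \<partial>M)"
  unfolding IA_def by (intro Bochner_Integration.integral_cong) (auto simp: indicator_def)

lemma IA_zero: "(\<And>x. x \<in> A \<Longrightarrow> u x = 0) \<Longrightarrow> IA A u = 0"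
  unfolding IA_def by (intro integral_eq_zero_AE AE_I2) (auto simp: indicator_def)

lemma IA_one: "\<eta> \<in> FB \<Longrightarrow> IA (cyl \<eta>) (\<lambda>x. 1) = of_real (m \<eta>)"
proof -
  assume e: "\<eta> \<in> FB"
  have "IA (cyl \<eta>) (\<lambda>x. 1) = (\<integral>x. complex_of_real (indicator (cyl \<eta>) x) \<partial>M)"
    unfolding IA_def by (intro Bochner_Integration.integral_cong) (auto simp: indicator_def)
  also have "\<dots> = complex_of_real (\<integral>x. indicator (cyl \<eta>) x \<partial>M)" by (rule integral_complex_of_real)
  also have "(\<integral>x. indicator (cyl \<eta>) x \<partial>M) = m \<eta>"
    using cyl_PB[of \<eta>] by (simp add: Int_absorb2 space_M measure_cyl[OF e])
  finally show ?thesis .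
qed

lemma IA_cmult: "IA A (\<lambda>x. c * u x) = c * IA A u"
proof -
  have "IA A (\<lambda>x. c * u x) = (\<integral>x. c * (indicator A x * u x) \<partial>M)"
    unfolding IA_def by (intro Bochner_Integration.integral_cong) auto
  then show ?thesis by (simp add: IA_def)
qed

lemma sqd_const: assumes "\<eta> \<in> FB" "\<And>x. x \<in> cyl \<eta> \<Longrightarrow> f x = c"
  shows "sqd (cyl \<eta>) f g = 0"
proof -
  have "IA (cyl \<eta>) f = c * of_real (m \<eta>)"
    using IA_cong[of "cyl \<eta>" f "\<lambda>x. c * 1"] assms IA_cmult[of _ c "\<lambda>x. 1"] IA_one by simp
  moreover have "IA (cyl \<eta>) (\<lambda>x. f x * g x) = c * IA (cyl \<eta>) g"
    using IA_cong[of "cyl \<eta>" "\<lambda>x. f x * g x" "\<lambda>x. c * g x"] assms IA_cmult[of _ c g] by simp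
  ultimately show ?thesis by (simp add: sqd_def measure_cyl[OF assms(1)])
qed

definition eigfun :: "'v fpath \<Rightarrow> 'v edge \<Rightarrow> 'v edge \<Rightarrow> 'v ipath \<Rightarrow> complex" where
  "eigfun \<gamma> e e' x = of_real (1 / m (add_edge \<gamma> e)) * indicator (cyl (add_edge \<gamma> e)) x +
     of_real (- 1 / m (add_edge \<gamma> e')) * indicator (cyl (add_edge \<gamma> e')) x"

lemma eigfun_domain: assumes "(e, e') \<in> ext1 L \<gamma>" shows "eigfun \<gamma> e e' \<in> form_domain L"
proof -
  let ?S = "{add_edge \<gamma> e, add_edge \<gamma> e'}"
  let ?c = "\<lambda>\<eta>. complex_of_real (if \<eta> = add_edge \<gamma> e then 1 / m (add_edge \<gamma> e) else - 1 / m (add_edge \<gamma> e'))"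
  have ne: "e \<noteq> e'" and F: "?S \<subseteq> FB" using assms by (auto simp: ext1_def)
  have "eigfun \<gamma> e e' = (\<lambda>x. \<Sum>\<eta>\<in>?S. ?c \<eta> * indicator (cyl \<eta>) x)"
    using ne by (intro ext, subst sum.insert) (simp_all add: eigfun_def)
  moreover have "finite ?S" by simp
  ultimately show ?thesis using F unfolding form_domain_def
    by (intro CollectI exI[of _ ?S] exI[of _ ?c] conjI)
qed

lemma eigfun_form:
  assumes c: "\<gamma> \<in> FB" and ee: "(e, e') \<in> ext1 L \<gamma>" and gd: "g \<in> form_domain L"
  shows "dirichlet_form L \<kappa> \<delta> s (eigfun \<gamma> e e') g =
     - of_real (eigval L \<kappa> \<delta> s \<gamma>) * (\<integral>x. eigfun \<gamma> e e' x * g x \<partial>M)"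
proof -
  define f where "f = eigfun \<gamma> e e'"
  define W where "W = (\<integral>x. f x * g x \<partial>M)"
  let ?n = "plength \<gamma>"
  have ne: "e \<noteq> e'" and F: "add_edge \<gamma> e \<in> FB" "add_edge \<gamma> e' \<in> FB"
    using ee by (auto simp: ext1_def)
  have g: "bmf g" by (rule form_domain_bmf[OF gd])
  have f: "bmf f" unfolding f_def by (rule form_domain_bmf[OF eigfun_domain[OF ee]])
  have re: "cnj (f x) = f x" for x by (simp add: f_def eigfun_def indicator_def)
  have supp: "f x = 0" if "x \<notin> cyl \<gamma>" for x
    using that by (simp add: f_def eigfun_def indicator_def cyl_extend)
  have fx: "f x = (if x ?n = e then of_real (1 / m (add_edge \<gamma> e)) else 0) +
       (if x ?n = e' then of_real (- 1 / m (add_edge \<gamma> e')) else 0)" if "x \<in> cyl \<gamma>" for x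
    using that by (simp add: f_def eigfun_def indicator_def cyl_extend)
  have f0: "(\<integral>x. f x \<partial>M) = 0"
  proof -
    have i: "integrable M (\<lambda>x. of_real r * indicator (cyl \<eta>) x :: complex)" if "\<eta> \<in> FB" for r \<eta>
      by (intro bmf_integrable bmf_mult bmf_const bmf_ind cyl_sets that)
    have j: "(\<integral>x. indicator (cyl \<eta>) x \<partial>M) = complex_of_real (m \<eta>)" if "\<eta> \<in> FB" for \<eta>
      using IA_one[OF that] by (simp add: IA_def)
    have "(\<integral>x. f x \<partial>M) = of_real (1 / m (add_edge \<gamma> e)) * of_real (m (add_edge \<gamma> e)) +
       of_real (- 1 / m (add_edge \<gamma> e')) * of_real (m (add_edge \<gamma> e'))"
      unfolding f_def eigfun_def
      by (simp only: Bochner_Integration.integral_add[OF i[OF F(1)] i[OF F(2)]]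
          integral_mult_right_zero j[OF F(1)] j[OF F(2)])
    also have "\<dots> = 0" using m_pos[OF F(1)] m_pos[OF F(2)] by (simp flip: of_real_mult of_real_add)
    finally show ?thesis .
  qed
  let ?p = "sub_path \<gamma>"
  have pF: "?p j \<in> FB" for j by (rule sub_path_FB[OF c])
  have sub: "x \<in> cyl (?p j)" if "f x \<noteq> 0" "j \<le> ?n" for x j
    using that supp cyl_sub by blast
  have sq: "sqd (cyl (?p j)) f g = of_real (m (?p j)) * W" if "j \<le> ?n" for j
  proof -
    have "IA (cyl (?p j)) f = 0"
      using f0 sub that by (subst IA_support) auto
    moreover have "IA (cyl (?p j)) (\<lambda>x. f x * g x) = W"
      unfolding W_def using sub that by (intro IA_support) auto
    ultimately show ?thesis by (simp add: sqd_def measure_cyl[OF pF])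
  qed
  have I: "(\<integral>z. indicator (branch_pairs L (?p j)) z * diffp f g z \<partial>(M \<Otimes>\<^sub>M M)) =
     2 * of_real (m (?p j) - m (?p (Suc j))) * W" if j: "j < ?n" for j
  proof -
    let ?O = "out_edges (plength (?p j)) (psource (?p j))"
    let ?a = "snd \<gamma> ! j"
    have pS: "?p (Suc j) = add_edge (?p j) ?a" by (rule sub_path_Suc[OF j])
    have aO: "?a \<in> ?O" using extend_FB_iff[OF pF[of j], of ?a] pF[of "Suc j"] pS by simp
    have oth: "sqd (cyl (add_edge (?p j) a)) f g = 0" if a: "a \<in> ?O - {?a}" for a
    proof (rule sqd_const[where c=0])
      show "add_edge (?p j) a \<in> FB" using a extend_FB_iff[OF pF[of j], of a] by simp
      fix x assume x: "x \<in> cyl (add_edge (?p j) a)"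
      show "f x = 0"
      proof (rule ccontr)
        assume "f x \<noteq> 0"
        then have "x \<in> cyl (add_edge (?p j) ?a)" using sub[of x "Suc j"] j pS by auto
        then show False using x a by (auto simp: cyl_extend)
      qed
    qed
    have "(\<Sum>a\<in>?O. sqd (cyl (add_edge (?p j) a)) f g) = sqd (cyl (add_edge (?p j) ?a)) f g"
      using finite_out[OF psource_Obj[OF pF[of j]]] aO oth
      by (subst sum.remove[of _ ?a]) (auto intro!: sum.neutral)
    also have "\<dots> = of_real (m (?p (Suc j))) * W" using sq[of "Suc j"] j pS by simp
    finally show ?thesis
      using sq[of j] j unfolding branch_integral[OF pF f g re] by (simp add: algebra_simps)
  qed
  have In: "(\<integral>z. indicator (branch_pairs L \<gamma>) z * diffp f g z \<partial>(M \<Otimes>\<^sub>M M)) = 2 * of_real (m \<gamma>) * W"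
  proof -
    let ?O = "out_edges (plength \<gamma>) (psource \<gamma>)"
    have "sqd (cyl (add_edge \<gamma> a)) f g = 0" if a: "a \<in> ?O" for a
      using extend_FB_iff[OF c, of a] a
      by (intro sqd_const[of _ f "(if a = e then of_real (1 / m (add_edge \<gamma> e)) else 0) +
           (if a = e' then of_real (- 1 / m (add_edge \<gamma> e')) else 0)"]) (auto simp: fx cyl_extend)
    then show ?thesis
      using sq[of ?n] unfolding branch_integral[OF c f g re] sub_path_all by simp
  qed
  have fin_sum: "(\<Sum>\<^sub>\<infinity>\<eta>\<in>FB. of_real (coef \<eta>) * diffp f g (\<phi> \<eta>)) =
      (\<Sum>j\<le>?n. of_real (coef (?p j)) * diffp f g (\<phi> (?p j)))"
    if phi: "\<phi> \<in> space (choice_measure L \<kappa>)" for \<phi>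
  proof -
    have inj: "inj_on ?p {..?n}"
      by (rule inj_onI) (metis atMost_iff plength_sub_path)
    have zero: "diffp f g (\<phi> \<eta>) = 0" if e: "\<eta> \<in> FB" and np: "\<eta> \<notin> ?p ` {..?n}" for \<eta>
    proof -
      obtain x y where xy: "\<phi> \<eta> = (x, y)" by force
      have "(x, y) \<in> branch_pairs L \<eta>" using space_choice[OF phi e] xy by simp
      then have B: "x \<in> cyl \<eta>" "y \<in> cyl \<eta>" by (simp_all add: branch_pairs_iff[OF e])
      have key: "u \<in> cyl (add_edge \<gamma> a)" if "v \<in> cyl (add_edge \<gamma> a)" "v \<in> cyl \<eta>" "u \<in> cyl \<eta>" for u v a
      proof (cases "plength \<eta> \<le> ?n")
        case True
        have v: "initial ?n v = \<gamma>" using that(1) unfolding cyl_extend by (simp add: cylinder_def)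
        have "\<eta> = initial (plength \<eta>) v" using that by (simp add: cylinder_def)
        also have "\<dots> = ?p (plength \<eta>)"
          using sub_path_initial[OF True, of v] v by simp
        finally show ?thesis using np True by blast
      next
        case False
        then have "initial (Suc ?n) u = initial (Suc ?n) v"
          using that(2,3) initial_le[of "plength \<eta>" u v "Suc ?n"] by (simp add: cylinder_def)
        then show ?thesis using that by (simp add: cylinder_def)
      qed
      have "x \<in> cyl (add_edge \<gamma> a) \<longleftrightarrow> y \<in> cyl (add_edge \<gamma> a)" for a
        using key[of x a y] key[of y a x] B by blast
      then have "f x = f y" unfolding f_def eigfun_def by (simp add: indicator_def)
      then show ?thesis using xy by (simp add: diffp_def)
    qed
    have "(\<Sum>\<^sub>\<infinity>\<eta>\<in>FB. of_real (coef \<eta>) * diffp f g (\<phi> \<eta>)) =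
        (\<Sum>\<^sub>\<infinity>\<eta>\<in>?p ` {..?n}. of_real (coef \<eta>) * diffp f g (\<phi> \<eta>))"
      using zero pF by (intro infsum_cong_neutral) auto
    also have "\<dots> = (\<Sum>\<eta>\<in>?p ` {..?n}. of_real (coef \<eta>) * diffp f g (\<phi> \<eta>))" by simp
    also have "\<dots> = (\<Sum>j\<le>?n. of_real (coef (?p j)) * diffp f g (\<phi> (?p j)))"
      using inj by (simp add: sum.reindex)
    finally show ?thesis .
  qed
  have dm: "diffp f g \<in> borel_measurable (M \<Otimes>\<^sub>M M)"
  proof -
    have [measurable]: "f \<in> borel_measurable M" "g \<in> borel_measurable M" using f g by auto
    have "diffp f g = (\<lambda>z. (f (fst z) - f (snd z)) * (g (fst z) - g (snd z)))"
      by (rule ext) (simp add: diffp_def re)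
    also have "\<dots> \<in> borel_measurable (M \<Otimes>\<^sub>M M)" by measurable
    finally show ?thesis .
  qed
  obtain B where dB: "\<And>z. cmod (diffp f g z) \<le> B"
  proof -
    obtain B1 B2 where b: "\<And>x. cmod (f x) \<le> B1" "\<And>x. cmod (g x) \<le> B2" using f g by (auto simp: bmf_def)
    have "cmod (diffp f g z) \<le> (B1 + B1) * (B2 + B2)" for z
      unfolding diffp_def norm_mult complex_mod_cnj
      using b by (intro mult_mono norm_ge_zero order_trans[OF norm_triangle_ineq4] add_mono)
        (auto intro: order_trans[OF norm_ge_zero])
    then show ?thesis by (rule that)
  qed
  note ci = choice_integral[OF pF dm dB]
  have "dirichlet_form L \<kappa> \<delta> s f g =
     1 / 2 * (\<integral>\<phi>. (\<Sum>j\<le>?n. of_real (coef (?p j)) * diffp f g (\<phi> (?p j))) \<partial>choice_measure L \<kappa>)"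
    unfolding form_eq using fin_sum
    by (intro arg_cong2[where f=times] refl Bochner_Integration.integral_cong) auto
  also have "(\<integral>\<phi>. (\<Sum>j\<le>?n. of_real (coef (?p j)) * diffp f g (\<phi> (?p j))) \<partial>choice_measure L \<kappa>) =
     (\<Sum>j\<le>?n. of_real (coef (?p j)) * (\<integral>\<phi>. diffp f g (\<phi> (?p j)) \<partial>choice_measure L \<kappa>))"
    using ci(1) by (subst Bochner_Integration.integral_sum) auto
  also have "\<dots> = (\<Sum>j\<le>?n. of_real (1 / G_fun L \<kappa> \<delta> s (?p j)) *
      (\<integral>z. indicator (branch_pairs L (?p j)) z * diffp f g z \<partial>(M \<Otimes>\<^sub>M M)))"
  proof (rule sum.cong[OF refl])
    fix j
    have "coef (?p j) / ext_mass L \<kappa> (?p j) = 1 / G_fun L \<kappa> \<delta> s (?p j)"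
      using w_pos[OF pF[of j]]
      by (simp add: coef_def G_fun_def ext_mass_def powr_divide)
    then show "of_real (coef (?p j)) * (\<integral>\<phi>. diffp f g (\<phi> (?p j)) \<partial>choice_measure L \<kappa>) =
       of_real (1 / G_fun L \<kappa> \<delta> s (?p j)) *
      (\<integral>z. indicator (branch_pairs L (?p j)) z * diffp f g z \<partial>(M \<Otimes>\<^sub>M M))"
      unfolding ci(2) by (metis (no_types, lifting) of_real_divide times_divide_eq_left times_divide_eq_right)
  qed
  also have "\<dots> = (\<Sum>j<?n. of_real (1 / G_fun L \<kappa> \<delta> s (?p j)) * (2 * of_real (m (?p j) - m (?p (Suc j))) * W))
     + of_real (1 / G_fun L \<kappa> \<delta> s \<gamma>) * (2 * of_real (m \<gamma>) * W)"
    using I In by (simp add: lessThan_Suc_atMost[symmetric] sub_path_all)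
  also have "1 / 2 * \<dots> = of_real ((\<Sum>j<?n. (m (?p j) - m (?p (Suc j))) / G_fun L \<kappa> \<delta> s (?p j))
      + m \<gamma> / G_fun L \<kappa> \<delta> s \<gamma>) * W"
  proof -
    have h: "1 / 2 * (complex_of_real (1 / c) * (2 * complex_of_real d * W)) = complex_of_real (d / c) * W" for c d
      by simp
    show ?thesis
      by (simp only: distrib_left sum_distrib_left h of_real_add of_real_sum distrib_right sum_distrib_right)
  qed
  also have "(\<Sum>j<?n. (m (?p j) - m (?p (Suc j))) / G_fun L \<kappa> \<delta> s (?p j)) + m \<gamma> / G_fun L \<kappa> \<delta> s \<gamma>
      = - eigval L \<kappa> \<delta> s \<gamma>"
    by (simp add: eigval_def sum_negf[symmetric] minus_divide_left)
  finally show ?thesis unfolding f_def W_def by simp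
qed

lemma eigval_laplace_beltrami:
  assumes c: "\<gamma> \<in> FB" and ee: "(e, e') \<in> ext1 L \<gamma>"
  shows "laplace_beltrami L \<kappa> \<delta> s (eigfun \<gamma> e e')
     (\<lambda>x. of_real (eigval L \<kappa> \<delta> s \<gamma>) * eigfun \<gamma> e e' x)"
proof -
  let ?f = "eigfun \<gamma> e e'"
  have f: "bmf ?f" by (rule form_domain_bmf[OF eigfun_domain[OF ee]])
  have re: "cnj (?f x) = ?f x" for x by (simp add: eigfun_def indicator_def)
  have L2: "L2_inner M (\<lambda>x. - (of_real (eigval L \<kappa> \<delta> s \<gamma>) * ?f x)) g =
      - of_real (eigval L \<kappa> \<delta> s \<gamma>) * (\<integral>x. ?f x * g x \<partial>M)" for g
  proof -
    have "L2_inner M (\<lambda>x. - (of_real (eigval L \<kappa> \<delta> s \<gamma>) * ?f x)) g =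
       (\<integral>x. - of_real (eigval L \<kappa> \<delta> s \<gamma>) * (?f x * g x) \<partial>M)"
      unfolding L2_inner_def by (intro Bochner_Integration.integral_cong) (auto simp: re)
    then show ?thesis by (simp only: integral_mult_right_zero)
  qed
  show ?thesis
    unfolding laplace_beltrami_def
    using eigfun_domain[OF ee] bmf_square[OF f] bmf_square[OF bmf_mult[OF bmf_const f]]
    by (auto simp: L2 eigfun_form[OF c ee] form_zero form_zero' intro!: exI[of _ "\<lambda>n. ?f"])
qed

lemma eigval_eigenvalue:
  assumes c: "\<gamma> \<in> FB" shows "laplace_eigenvalue L \<kappa> \<delta> s (eigval L \<kappa> \<delta> s \<gamma>)"
proof -
  obtain e e' where ee: "(e, e') \<in> ext1 L \<gamma>" using ext1_ne[OF c] by auto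
  then have ne: "e \<noteq> e'" and F: "add_edge \<gamma> e \<in> FB" by (auto simp: ext1_def)
  have "\<not> (AE x in M. eigfun \<gamma> e e' x = 0)"
  proof
    assume "AE x in M. eigfun \<gamma> e e' x = 0"
    then have "AE x in M. x \<notin> cyl (add_edge \<gamma> e)"
    proof eventually_elim
      case (elim x)
      show ?case
      proof
        assume "x \<in> cyl (add_edge \<gamma> e)"
        moreover from this have "x \<notin> cyl (add_edge \<gamma> e')" using ne by (auto simp: cyl_extend)
        ultimately show False using elim m_pos[OF F] by (simp add: eigfun_def)
      qed
    qed
    moreover have "cyl (add_edge \<gamma> e) \<in> sets M" by (rule cyl_sets[OF F])
    ultimately have "emeasure M (cyl (add_edge \<gamma> e)) = 0"
      using AE_iff_measurable[of "cyl (add_edge \<gamma> e)" M "\<lambda>x. x \<notin> cyl (add_edge \<gamma> e)"]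
        sets.sets_into_space[of "cyl (add_edge \<gamma> e)" M] by auto
    then show False using emeasure_cyl[OF F] m_pos[OF F] by simp
  qed
  then show ?thesis using eigval_laplace_beltrami[OF c ee] unfolding laplace_eigenvalue_def by blast
qed

end

end

theory Submission
  imports Defs
begin

text \<open>Every term of the sum defining \<open>eigval\<close> is nonpositive because \<open>\<mu>\<close> decreases along a path,
  so only \<open>- \<mu>[\<gamma>] / G\<^sub>s(\<gamma>)\<close> matters. Bounding the off-diagonal mass in \<open>G\<^sub>s(\<gamma>)\<close> by
  \<open>\<mu>[\<gamma>]\<^sup>2\<close> gives \<open>\<mu>[\<gamma>] / G\<^sub>s(\<gamma>) \<ge> 2 / (w(\<gamma>)\<^bsup>2-s\<^esup> \<mu>[\<gamma>])\<close>, and with \<open>c\<close> the product of the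
  spectral radii met along \<open>\<gamma>\<close> the right-hand side is, up to powers of \<open>\<kappa>\<close>,
  \<open>c\<^bsup>(2+\<delta>-s)/\<delta>\<^esup>\<close>, which grows at least exponentially in the length of \<open>\<gamma>\<close>.\<close>

context pf_kgraph
begin

text \<open>The one-edge extensions of \<open>\<eta>\<close> share out its mass: their masses are
  nonnegative and sum to \<open>m \<eta>\<close> by \<open>m_sum\<close>.\<close>

lemma mu_add_le:
  assumes \<eta>: "\<eta> \<in> FB" and e: "add_edge \<eta> e \<in> FB"
  shows "m (add_edge \<eta> e) \<le> m \<eta>"
proof -
  let ?O = "out_edges (plength \<eta>) (psource \<eta>)"
  have "e \<in> ?O" using e by (simp add: extend_FB_iff[OF \<eta>])
  moreover have "0 \<le> m (add_edge \<eta> a)" if "a \<in> ?O" for a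
    using m_pos[of "add_edge \<eta> a"] that by (simp add: extend_FB_iff[OF \<eta>])
  ultimately have "m (add_edge \<eta> e) \<le> (\<Sum>a\<in>?O. m (add_edge \<eta> a))"
    by (intro member_le_sum finite_out psource_Obj \<eta>) auto
  then show ?thesis by (simp add: m_sum[OF \<eta>])
qed

text \<open>Admitting the diagonal pairs \<open>e = e'\<close> adds only nonnegative terms, and the
  full double sum factors into a square.\<close>

lemma ext_mass_le:
  assumes \<eta>: "\<eta> \<in> FB" shows "ext_mass L \<kappa> \<eta> \<le> (m \<eta>)\<^sup>2"
proof -
  let ?O = "out_edges (plength \<eta>) (psource \<eta>)"
  have pos: "0 \<le> m (add_edge \<eta> a)" if "a \<in> ?O" for a
    using m_pos[of "add_edge \<eta> a"] that by (simp add: extend_FB_iff[OF \<eta>])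
  have "ext_mass L \<kappa> \<eta> \<le> (\<Sum>(e, e')\<in>?O \<times> ?O. m (add_edge \<eta> e) * m (add_edge \<eta> e'))"
    unfolding ext_mass_def
    by (rule sum_mono2) (auto simp: ext1_eq[OF \<eta>] finite_out[OF psource_Obj[OF \<eta>]] pos)
  also have "\<dots> = (m \<eta>)\<^sup>2"
    by (simp add: sum.cartesian_product[symmetric] sum_product[symmetric] m_sum[OF \<eta>] power2_eq_square)
  finally show ?thesis .
qed

text \<open>The diameter hypothesis forces every finite path to branch (\<open>ext1_ne\<close>), so
  the sum over \<open>ext1\<close> is nonempty with positive terms.\<close>

lemma G_fun_pos: "\<eta> \<in> FB \<Longrightarrow> G_fun L \<kappa> \<delta> s \<eta> > 0"
  using w_pos[of \<eta>] ext_mass_pos[of \<eta>] by (simp add: G_fun_def ext_mass_def)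

lemma eigval_le_last_term:
  assumes \<gamma>: "\<gamma> \<in> FB" shows "eigval L \<kappa> \<delta> s \<gamma> \<le> - (m \<gamma> / G_fun L \<kappa> \<delta> s \<gamma>)"
proof -
  have "(m (sub_path \<gamma> (Suc j)) - m (sub_path \<gamma> j)) / G_fun L \<kappa> \<delta> s (sub_path \<gamma> j) \<le> 0"
    if "j < plength \<gamma>" for j
  proof -
    have "m (sub_path \<gamma> (Suc j)) \<le> m (sub_path \<gamma> j)"
      using mu_add_le[OF sub_path_FB[OF \<gamma>]] sub_path_FB[OF \<gamma>, of "Suc j"]
      by (simp add: sub_path_Suc[OF that])
    then show ?thesis
      using G_fun_pos[OF sub_path_FB[OF \<gamma>, of j]] by (intro divide_nonpos_pos) auto
  qed
  then have "(\<Sum>j<plength \<gamma>. (m (sub_path \<gamma> (Suc j)) - m (sub_path \<gamma> j)) /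
      G_fun L \<kappa> \<delta> s (sub_path \<gamma> j)) \<le> 0"
    by (intro sum_nonpos) auto
  then show ?thesis by (simp add: eigval_def)
qed

lemma mu_over_G_fun_ge:
  assumes \<gamma>: "\<gamma> \<in> FB"
  shows "2 * cfac (plength \<gamma>) powr ((2 + \<delta> - s) / \<delta>) / \<kappa> (psource \<gamma>) powr (3 - s)
    \<le> m \<gamma> / G_fun L \<kappa> \<delta> s \<gamma>"
proof -
  let ?c = "cfac (plength \<gamma>)" and ?k = "\<kappa> (psource \<gamma>)"
  note k = kappa_pos[OF psource_Obj[OF \<gamma>]] and c = cfac_pos[of "plength \<gamma>"]
  note m = m_pos[OF \<gamma>]
  \<comment> \<open>Count powers: \<open>w \<gamma>\<close> is
    \<open>?c powr (- 1 / \<delta>) * ?k\<close> and \<open>m \<gamma>\<close> is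
    \<open>?k / ?c\<close>. The resulting exponent of \<open>?c\<close> is negative exactly when
    \<open>s < 2 + \<delta>\<close>, which is where the threshold comes from.\<close>
  have "w \<gamma> powr (2 - s) * m \<gamma> = ?c powr (- (2 - s) / \<delta> - 1) * ?k powr (2 - s + 1)"
  proof -
    have "w \<gamma> powr (2 - s) = ?c powr (- (2 - s) / \<delta>) * ?k powr (2 - s)"
    proof -
      have "- 1 / \<delta> * (2 - s) = - (2 - s) / \<delta>"
        by (simp only: times_divide_eq_left mult_minus_left mult_1)
      then show ?thesis
        using k c unfolding w_eq by (simp only: powr_mult powr_powr)
    qed
    moreover have "m \<gamma> = ?c powr - 1 * ?k powr 1"
      using k c by (simp add: m_eq powr_minus_divide)
    ultimately show ?thesis
      by (simp only: powr_add diff_conv_add_uminus mult_ac)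
  qed
  also have "- (2 - s) / \<delta> - 1 = - ((2 + \<delta> - s) / \<delta>)"
    using delta by (simp add: field_simps)
  finally have wm: "w \<gamma> powr (2 - s) * m \<gamma> = ?k powr (3 - s) / ?c powr ((2 + \<delta> - s) / \<delta>)"
    by (simp add: powr_minus_divide)
  have "G_fun L \<kappa> \<delta> s \<gamma> \<le> w \<gamma> powr (2 - s) * (m \<gamma>)\<^sup>2 / 2"
    using ext_mass_le[OF \<gamma>] by (simp add: G_fun_def ext_mass_def mult_left_mono)
  then have "m \<gamma> / (w \<gamma> powr (2 - s) * (m \<gamma>)\<^sup>2 / 2) \<le> m \<gamma> / G_fun L \<kappa> \<delta> s \<gamma>"
    using G_fun_pos[OF \<gamma>] m by (intro divide_left_mono mult_pos_pos) (auto intro: less_le_trans)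
  moreover have "m \<gamma> / (w \<gamma> powr (2 - s) * (m \<gamma>)\<^sup>2 / 2) = 2 / (w \<gamma> powr (2 - s) * m \<gamma>)"
    using m by (simp add: power2_eq_square)
  ultimately show ?thesis by (simp add: wm)
qed

text \<open>Only finitely many colours occur, so the least spectral radius \<open>r\<close> still
  exceeds 1, and a product of \<open>n\<close> factors is at least \<open>r ^ n\<close>.\<close>

lemma filterlim_cfac: "filterlim cfac at_top sequentially"
proof -
  define r where "r = Min (rho L ` {1..rk L})"
  have fin: "finite (rho L ` {1..rk L})" and ne: "rho L ` {1..rk L} \<noteq> {}"
    using rk_pos by auto
  have r1: "1 < r" using rho_gt1 fin ne by (auto simp: r_def)
  have "r \<le> rho L (col j)" for j
    unfolding r_def by (rule Min_le[OF fin imageI[OF col_in]])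
  then have "r ^ n \<le> cfac n" for n
    unfolding cfac_def using prod_mono[of "{..<n}" "\<lambda>_. r" "\<lambda>j. rho L (col j)"] r1 by simp
  then have "\<exists>N. \<forall>n\<ge>N. Z \<le> cfac n" for Z
    using real_arch_pow[OF r1, of Z] r1
    by (meson less_imp_le order_trans power_increasing)
  then show ?thesis by (simp add: filterlim_at_top eventually_sequentially)
qed

text \<open>A single \<open>N\<close> serves all paths: \<open>cfac\<close> depends only on the
  length, and the remaining dependence on the source is bounded by a constant.\<close>

lemma eigval_unbounded_below:
  assumes s: "s < 2 + \<delta>"
  shows "\<exists>N. \<forall>\<gamma>\<in>FB. N \<le> plength \<gamma> \<longrightarrow> eigval L \<kappa> \<delta> s \<gamma> < - C"
proof -
  \<comment> \<open>As a sum of nonnegative terms, \<open>K\<close> dominates each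
    \<open>\<kappa> v powr (3 - s)\<close> whatever the sign of \<open>3 - s\<close>.\<close>
  define K where "K = (\<Sum>v\<in>Obj L. \<kappa> v powr (3 - s))"
  let ?a = "(2 + \<delta> - s) / \<delta>"
  \<comment> \<open>Since \<open>s < 2 + \<delta>\<close> and \<open>\<delta> > 0\<close>, the
    exponent \<open>?a\<close> is positive.\<close>
  have "filterlim (\<lambda>n. cfac n powr ?a) at_top sequentially"
  proof -
    have "filterlim (\<lambda>n. exp (?a * ln (cfac n))) at_top sequentially"
      using s delta
      by (intro filterlim_compose[OF exp_at_top] filterlim_compose[OF ln_at_top filterlim_cfac]
          filterlim_tendsto_pos_mult_at_top[OF tendsto_const]) simp
    then show ?thesis using cfac_pos by (simp add: powr_def less_imp_neq[symmetric])
  qed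
  then have "eventually (\<lambda>n. C * K / 2 < cfac n powr ?a) sequentially"
    by (simp only: filterlim_at_top_dense)
  then have "eventually (\<lambda>n. C * K < 2 * cfac n powr ?a) sequentially"
    by (rule eventually_mono) linarith
  then obtain N where N: "\<And>n. N \<le> n \<Longrightarrow> C * K < 2 * cfac n powr ?a"
    by (auto simp: eventually_sequentially)
  have "eigval L \<kappa> \<delta> s \<gamma> < - C" if \<gamma>: "\<gamma> \<in> FB" and n: "N \<le> plength \<gamma>" for \<gamma>
  proof -
    let ?k = "\<kappa> (psource \<gamma>) powr (3 - s)"
    have k: "0 < ?k" using kappa_pos[OF psource_Obj[OF \<gamma>]] by simp
    have kK: "?k \<le> K"
      unfolding K_def by (rule member_le_sum[OF psource_Obj[OF \<gamma>] _ finite_Obj]) simp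
    have "C < 2 * cfac (plength \<gamma>) powr ?a / K"
      using N[OF n] less_le_trans[OF k kK] by (simp add: pos_less_divide_eq)
    also have "\<dots> \<le> 2 * cfac (plength \<gamma>) powr ?a / ?k"
      by (intro divide_left_mono kK mult_pos_pos k less_le_trans[OF k kK]) simp
    also have "\<dots> \<le> m \<gamma> / G_fun L \<kappa> \<delta> s \<gamma>" by (rule mu_over_G_fun_ge[OF \<gamma>])
    finally show ?thesis using eigval_le_last_term[OF \<gamma>] by linarith
  qed
  then show ?thesis by blast
qed

end

theorem proposition3p2:
  fixes L :: "('v, 'a) kgraph" and \<kappa> :: "'v \<Rightarrow> real" and \<delta> s :: real
  assumes "k_graph L" and "finite_kgraph L" and "strongly_connected_kgraph L"
    and "\<forall>i\<in>{1..rk L}. rho L i > 1"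
    and "perron_frobenius_vector L \<kappa>"
    and "0 < \<delta>" and "\<delta> < 1"
    and "\<forall>\<eta>\<in>finite_paths L. cylinder_diam L \<kappa> \<delta> \<eta> = weight L \<kappa> \<delta> \<eta>"
  shows "(\<forall>\<gamma>\<in>finite_paths L. laplace_eigenvalue L \<kappa> \<delta> s (eigval L \<kappa> \<delta> s \<gamma>)) \<and>
    (s < 2 + \<delta> \<longrightarrow>
      (\<forall>C>0. \<exists>N. \<forall>\<gamma>\<in>finite_paths L. plength \<gamma> \<ge> N \<longrightarrow> eigval L \<kappa> \<delta> s \<gamma> < - C))"
proof -
  interpret pf_kgraph L \<kappa> \<delta> s
    using assms by unfold_locales auto
  show ?thesis using eigval_eigenvalue eigval_unbounded_below by blast
qed

end
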